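(* (1) If there is an Ł$_{3_{n\vee}}$ proof of a formula $A$ in $n$ steps, then there is an $\mathcal{H}\text{Łuk}$ proof of $A$ in $O(n\cdot\alpha(n))$ steps, where $\alpha$ is the inverse Ackermann function. (2) If there is an Ł$_{3_{n\vee}}$ proof of $A$ in $n$ steps in which assumptions are opened $m$ times, then (for each fixed $i\ge0$) there is an $\mathcal{H}\text{Łuk}$ proof of $A$ in $O(n\cdot m\log^{( *i)}m)$ steps.
   Context: Formulas are built from propositional variables with $\wedge,\vee,\supset,\neg$. $\mathcal{H}\text{Łuk}$ (Avron's Frege system for 3-valued Łukasiewicz logic) has the axiom schemas: (1) $A\supset(B\supset A)$; (2) $(A\supset B)\supset((B\supset C)\supset(A\supset C))$; (3) $((A\supset B)\supset B)\supset((B\supset A)\supset A)$; (4) $((((A\supset B)\supset A)\supset A)\supset(B\supset C))\supset(B\supset C)$; (5) $(A\wedge B)\supset A$; (6) $(A\wedge B)\supset B$; (7) $(A\supset B)\supset((A\supset C)\supset(A\supset(B\wedge C)))$; (8) $A\supset(A\vee B)$; (9) $B\supset(A\vee B)$; (10) $(A\supset C)\supset((B\supset C)\supset((A\vee B)\supset C))$; (11) $(\neg B\supset\neg A)\supset(A\supset B)$; sole rule modus ponens; steps = length of proof. Ł$_{3_{n\vee}}$ (nested disjunction system): a proof is a sequence of lines, each a formula with a context (a finite sequence of open assumptions; the initial context is empty). A line is available to a later line if its context is an initial subsequence of the later line's context and it does not lie in an already closed assumption block. Lines may be: (i) an instance of an $\mathcal{H}\text{Łuk}$ axiom schema (context unchanged);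 (ii) the opening of an assumption $A$: line $A$ with context $\Gamma*\langle A\rangle$, $\Gamma$ the context of the last available line; (iii) $B$ by modus ponens from available lines $C$ and $C\supset B$; (iv) $\vee_{ne}$: if $A\vee B$ is available in context $\Gamma$, a block opened by assumption $A$ (context $\Gamma*\langle A\rangle$) ends with $C$, and a block opened by assumption $B$ (context $\Gamma*\langle B\rangle$) ends with $C$, then both blocks are closed (their lines become unavailable) and $C$ is written with context $\Gamma$. A proof of $A$ ends with $A$ in empty context; steps = number of lines. Iterated logarithms: $\log^{( *0)}m=\log_2m$, and $\log^{( *(i+1))}m$ is the least number of applications of $\log^{( *i)}$ bringing $m$ to at most $1$; the constant in (2) may depend on $i$.
   Formalization: In (2) the factor m log^( *i) m is replaced by max(1, m log^( *i) m), since for m = 0 (no assumptions opened) the stated bound would be 0 or undefined while every proof has at least one step; for m ≥ 2 nothing changes. *)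

theory Defs
  imports Complex_Main "HOL-Library.Sublist"
begin

datatype fm =
    Var nat
  | Neg fm
  | Conj fm fm  (infixr "\<^bold>\<and>" 35)
  | Disj fm fm  (infixr "\<^bold>\<or>" 30)
  | Imp fm fm   (infixr "\<^bold>\<supset>" 25)

inductive luk_axiom :: "fm \<Rightarrow> bool" where
  "luk_axiom (A \<^bold>\<supset> (B \<^bold>\<supset> A))"
| "luk_axiom ((A \<^bold>\<supset> B) \<^bold>\<supset> ((B \<^bold>\<supset> C) \<^bold>\<supset> (A \<^bold>\<supset> C)))"
| "luk_axiom (((A \<^bold>\<supset> B) \<^bold>\<supset> B) \<^bold>\<supset> ((B \<^bold>\<supset> A) \<^bold>\<supset> A))"
| "luk_axiom (((((A \<^bold>\<supset> B) \<^bold>\<supset> A) \<^bold>\<supset> A) \<^bold>\<supset> (B \<^bold>\<supset> C)) \<^bold>\<supset> (B \<^bold>\<supset> C))"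
| "luk_axiom ((A \<^bold>\<and> B) \<^bold>\<supset> A)"
| "luk_axiom ((A \<^bold>\<and> B) \<^bold>\<supset> B)"
| "luk_axiom ((A \<^bold>\<supset> B) \<^bold>\<supset> ((A \<^bold>\<supset> C) \<^bold>\<supset> (A \<^bold>\<supset> (B \<^bold>\<and> C))))"
| "luk_axiom (A \<^bold>\<supset> (A \<^bold>\<or> B))"
| "luk_axiom (B \<^bold>\<supset> (A \<^bold>\<or> B))"
| "luk_axiom ((A \<^bold>\<supset> C) \<^bold>\<supset> ((B \<^bold>\<supset> C) \<^bold>\<supset> ((A \<^bold>\<or> B) \<^bold>\<supset> C)))"
| "luk_axiom ((Neg B \<^bold>\<supset> Neg A) \<^bold>\<supset> (A \<^bold>\<supset> B))"

definition hluk_proof :: "fm list \<Rightarrow> fm \<Rightarrow> bool" where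
  "hluk_proof Q A \<longleftrightarrow>
     Q \<noteq> [] \<and> last Q = A \<and>
     (\<forall>i<length Q. luk_axiom (Q ! i) \<or> (\<exists>j<i. \<exists>k<i. Q ! k = (Q ! j \<^bold>\<supset> Q ! i)))"

text \<open>
  Lines of a nested-disjunction proof carry their justification.  \<open>Open\<close> opens an
  assumption on top of the current context.  \<open>OpenAlt a\<close> opens the second of the two
  blocks of a later disjunction elimination: the block opened at line \<open>a\<close> ends at the
  preceding line, and the new assumption is put on top of the context in which line
  \<open>a\<close> was opened.  \<open>OrE d a b\<close> eliminates the disjunction on line \<open>d\<close>, with the two
  blocks opened at lines \<open>a\<close> and \<open>b\<close>.  Lines are numbered from 0.
\<close>

datatype just = Axiom | Open | OpenAlt nat | MP nat nat | OrE nat nat nat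

datatype line = Line (form: fm) (ctx: "fm list") (just: just)

text \<open>
  The lines of the two blocks of \<open>OrE d a b\<close> on line \<open>k\<close> are exactly those numbered
  from \<open>a\<close> to \<open>k - 1\<close>.
\<close>

definition closed_before :: "line list \<Rightarrow> nat \<Rightarrow> nat \<Rightarrow> bool" where
  "closed_before P i j \<longleftrightarrow>
     (\<exists>k<i. \<exists>d a b. just (P ! k) = OrE d a b \<and> a \<le> j \<and> j < k)"

definition available :: "line list \<Rightarrow> nat \<Rightarrow> nat \<Rightarrow> bool" where
  "available P i j \<longleftrightarrow>
     j < i \<and> prefix (ctx (P ! j)) (ctx (P ! i)) \<and> \<not> closed_before P i j"

text \<open>
  The line directly before line \<open>i\<close> never lies in a closed block, so its context is
  the one of the last available line.
\<close>

definition current_ctx :: "line list \<Rightarrow> nat \<Rightarrow> fm list" where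
  "current_ctx P i = (if i = 0 then [] else ctx (P ! (i - 1)))"

text \<open>
  The block opened at line \<open>a\<close> consists of the lines \<open>a, ..., e - 1\<close>, and its last line
  is in the context of its opening line.  The condition on \<open>OpenAlt\<close> keeps the two
  blocks of a disjunction elimination apart when both have the same assumption.
\<close>

definition block :: "line list \<Rightarrow> nat \<Rightarrow> nat \<Rightarrow> bool" where
  "block P a e \<longleftrightarrow>
     a < e \<and> ctx (P ! (e - 1)) = ctx (P ! a) \<and>
     (\<forall>k\<in>{a<..<e}. prefix (ctx (P ! a)) (ctx (P ! k)) \<and> just (P ! k) \<noteq> OpenAlt a)"

definition line_ok :: "line list \<Rightarrow> nat \<Rightarrow> bool" where
  "line_ok P i \<longleftrightarrow>
     (case just (P ! i) of
        Axiom \<Rightarrow> luk_axiom (form (P ! i)) \<and> ctx (P ! i) = current_ctx P i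
      | Open \<Rightarrow> ctx (P ! i) = current_ctx P i @ [form (P ! i)]
      | OpenAlt a \<Rightarrow>
          block P a i \<and> just (P ! a) = Open \<and>
          (\<exists>\<Gamma>. ctx (P ! a) = \<Gamma> @ [form (P ! a)] \<and> ctx (P ! i) = \<Gamma> @ [form (P ! i)])
      | MP j k \<Rightarrow>
          ctx (P ! i) = current_ctx P i \<and> available P i j \<and> available P i k \<and>
          form (P ! k) = (form (P ! j) \<^bold>\<supset> form (P ! i))
      | OrE d a b \<Rightarrow>
          available P i d \<and>
          (form (P ! d) = (form (P ! a) \<^bold>\<or> form (P ! b)) \<or>
           form (P ! d) = (form (P ! b) \<^bold>\<or> form (P ! a))) \<and>
          just (P ! b) = OpenAlt a \<and> block P a b \<and> block P b i \<and>
          ctx (P ! a) = ctx (P ! i) @ [form (P ! a)] \<and>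
          ctx (P ! b) = ctx (P ! i) @ [form (P ! b)] \<and>
          form (P ! (b - 1)) = form (P ! i) \<and> form (P ! (i - 1)) = form (P ! i))"

definition nested_disj_proof :: "line list \<Rightarrow> fm \<Rightarrow> bool" where
  "nested_disj_proof P A \<longleftrightarrow>
     P \<noteq> [] \<and> form (last P) = A \<and> ctx (last P) = [] \<and> (\<forall>i<length P. line_ok P i)"

definition opens :: "line \<Rightarrow> bool" where
  "opens l \<longleftrightarrow> just l = Open \<or> (\<exists>a. just l = OpenAlt a)"

definition num_openings :: "line list \<Rightarrow> nat" where
  "num_openings P = length (filter opens P)"

text \<open>
  The variant of the Ackermann function starting from doubling; other common variants
  change its inverse only by an additive constant.  Note \<open>inv_ackermann n \<ge> 1\<close> for all \<open>n\<close>.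
\<close>

fun ackermann :: "nat \<Rightarrow> nat \<Rightarrow> nat" where
  "ackermann 0 m = 2 * m"
| "ackermann (Suc n) 0 = 1"
| "ackermann (Suc n) (Suc m) = ackermann n (ackermann (Suc n) m)"

definition inv_ackermann :: "nat \<Rightarrow> nat" where
  "inv_ackermann n = (LEAST i. n < ackermann i i)"

primrec log_iter :: "nat \<Rightarrow> real \<Rightarrow> real" where
  "log_iter 0 = log 2"
| "log_iter (Suc i) = (\<lambda>x. real (LEAST k. (log_iter i ^^ k) x \<le> 1))"

end

theory Submission
  imports Defs
begin

text \<open>
  A line \<open>B\<close> in context \<open>\<langle>A\<^sub>1, \<dots>, A\<^sub>k\<rangle>\<close> is translated to \<open>\<gamma> \<supset> (\<gamma> \<supset> B)\<close>, where \<open>\<gamma>\<close> is the conjunction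
  of the context. By the three-valued contraction law, modus ponens and disjunction elimination
  each cost a bounded number of lines, except that a line from an outer context \<open>\<gamma>'\<close> has to be
  imported by means of \<open>\<gamma> \<supset> \<gamma>'\<close>. The contexts form a tree with at most one node more than there are
  opened assumptions; its edges are instances of axiom schema (5), and the implications needed are
  ancestor queries, to be answered by composing edges.

  To answer them, cut the tree into small components by few cut points, and add shortcuts from every
  node to the next cut point above it and from every cut point to the nodes between it and the next
  cut point. Recursion on the tree of cut points and on the components follows the recursion of the
  Ackermann function, and gives \<open>O(k j N)\<close> shortcuts with which every query on a tree with
  \<open>N \<le> ackermann k j\<close> nodes is answered in \<open>2 k + 1\<close> hops. The choice \<open>k = \<alpha>(n) + 2\<close>, \<open>j = 3\<close> yields
  the first bound. For the second one no shortcuts are needed: a query takes at most \<open>m + 1\<close> hops,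
  and \<open>log_iter i m \<ge> 1\<close> for \<open>m \<ge> 2\<close>.
\<close>

subsection \<open>Shortcuts in trees\<close>

text \<open>The count models proof length: a pair stands for a proved implication between context
  formulas, and one composition is one use of transitivity. The rule \<open>idle\<close> makes the
  count an upper bound, so that estimates can be rounded up.\<close>

inductive trcl_steps :: "'a rel \<Rightarrow> nat \<Rightarrow> 'a rel \<Rightarrow> bool" for B where
  base: "trcl_steps B 0 B"
| step: "trcl_steps B n E \<Longrightarrow> (u, v) \<in> E \<Longrightarrow> (v, w) \<in> E \<Longrightarrow> trcl_steps B (Suc n) (insert (u, w) E)"
| idle: "trcl_steps B n E \<Longrightarrow> trcl_steps B (Suc n) E"

lemma trcl_steps_mono: "trcl_steps B n E \<Longrightarrow> n \<le> m \<Longrightarrow> trcl_steps B m E"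
  by (induction m) (auto simp: le_Suc_eq intro: trcl_steps.idle)

lemma trcl_steps_Un: "trcl_steps B n E \<Longrightarrow> trcl_steps (B \<union> C) n (E \<union> C)"
proof (induction rule: trcl_steps.induct)
  case (step n E u v w)
  then show ?case using trcl_steps.step[of "B \<union> C" n "E \<union> C" u v w] by simp
qed (auto intro: trcl_steps.intros)

lemma trcl_steps_trans: "trcl_steps E m F \<Longrightarrow> trcl_steps B n E \<Longrightarrow> trcl_steps B (n + m) F"
  by (induction rule: trcl_steps.induct) (auto intro: trcl_steps.intros)

lemma trcl_steps_extend:
  assumes "trcl_steps B n E" and "trcl_steps C m F" and "C \<subseteq> E"
  shows "trcl_steps B (n + m) (E \<union> F)"
proof -
  have "trcl_steps (C \<union> E) m (F \<union> E)"
    using assms(2) by (rule trcl_steps_Un)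
  then have "trcl_steps E m (E \<union> F)"
    using assms(3) by (simp add: Un_absorb1 Un_commute)
  then show ?thesis
    using assms(1) by (rule trcl_steps_trans)
qed

lemma trcl_steps_UN:
  assumes "finite I" and "\<And>i. i \<in> I \<Longrightarrow> trcl_steps (C i) (f i) (E i)" and "\<And>i. i \<in> I \<Longrightarrow> C i \<subseteq> B"
  shows "trcl_steps B (sum f I) (B \<union> (\<Union>i\<in>I. E i))"
  using assms
proof (induction I rule: finite_induct)
  case empty
  then show ?case by (simp add: trcl_steps.base)
next
  case (insert i I)
  have "trcl_steps B (sum f I + f i) ((B \<union> (\<Union>i\<in>I. E i)) \<union> E i)"
    using insert by (intro trcl_steps_extend[where C = "C i"]) auto
  then show ?case
    using insert.hyps by (simp add: ac_simps)
qed

text \<open>Add the pairs of \<open>D\<close> in order of increasing rank: each is then a single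
  composition of pairs already present, so one step per pair is enough.\<close>

lemma trcl_steps_ranked:
  fixes rank :: "'a \<times> 'a \<Rightarrow> nat"
  assumes "finite D"
    and "\<And>u w. (u, w) \<in> D \<Longrightarrow> (u, w) \<in> B \<or>
      (\<exists>v. ((u, v) \<in> B \<or> (u, v) \<in> D \<and> rank (u, v) < rank (u, w)) \<and>
           ((v, w) \<in> B \<or> (v, w) \<in> D \<and> rank (v, w) < rank (u, w)))"
  shows "trcl_steps B (card D) (B \<union> D)"
  using assms
proof (induction D rule: finite_ranking_induct[where f = rank])
  case empty
  then show ?case by (simp add: trcl_steps.base)
next
  case (insert x S)
  obtain u w where x: "x = (u, w)" by force
  have IH: "trcl_steps B (card S) (B \<union> S)"
  proof (rule insert.IH)
    fix u' w' assume m: "(u', w') \<in> S"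
    \<comment> \<open>The pair \<open>x\<close> has maximal rank, so no splitting of a pair of
      \<open>S\<close> into pairs of smaller rank can use it.\<close>
    then have le: "rank (u', w') \<le> rank x" using insert.hyps by blast
    show "(u', w') \<in> B \<or>
      (\<exists>v. ((u', v) \<in> B \<or> (u', v) \<in> S \<and> rank (u', v) < rank (u', w')) \<and>
           ((v, w') \<in> B \<or> (v, w') \<in> S \<and> rank (v, w') < rank (u', w')))"
      using insert.prems[of u' w'] m le by (auto simp: x)
  qed
  show ?case
  proof (cases "x \<in> B \<union> S")
    case True
    then show ?thesis
      using trcl_steps_mono[OF IH] insert.hyps(1)
      by (auto simp: insert_absorb card_insert_le)
  next
    case False
    then obtain v where "(u, v) \<in> B \<union> S" "(v, w) \<in> B \<union> S"
      using insert.prems[of u w] by (auto simp: x)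
    then have "trcl_steps B (Suc (card S)) (insert (u, w) (B \<union> S))"
      using IH by (blast intro: trcl_steps.step)
    then show ?thesis
      using False insert.hyps(1) by (simp add: x)
  qed
qed

text \<open>The edges from a node to its parent, ancestors being prefixes. \<open>X\<close> may be
  any set of lists, so that the notion also applies to the cut points and to the components, which
  form forests of their own.\<close>

definition covers :: "'a list set \<Rightarrow> 'a list rel" where
  "covers X = {(u, w). u \<in> X \<and> w \<in> X \<and> strict_prefix w u \<and>
     \<not> (\<exists>v\<in>X. strict_prefix w v \<and> strict_prefix v u)}"

text \<open>Adding \<open>Id\<close> turns the exact power into "at most \<open>h\<close>
  hops".\<close>

definition hop_bound :: "'a list set \<Rightarrow> nat \<Rightarrow> 'a list rel \<Rightarrow> bool" where
  "hop_bound X h E \<longleftrightarrow> (\<forall>u\<in>X. \<forall>w\<in>X. prefix w u \<longrightarrow> (u, w) \<in> (E \<union> Id) ^^ h)"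

lemma relpow_Id_mono:
  assumes a: "(u, w) \<in> (E \<union> Id) ^^ h" "E \<subseteq> F" "h \<le> k"
  shows "(u, w) \<in> (F \<union> Id) ^^ k"
proof -
  have "(E \<union> Id) ^^ h \<subseteq> (F \<union> Id) ^^ h"
    using a(2) by (induction h) auto
  moreover have "(u, w) \<in> (F \<union> Id) ^^ (h + d)" if "(u, w) \<in> (F \<union> Id) ^^ h" for d
    using that by (induction d) (auto intro: relcompI)
  ultimately show ?thesis using a by (metis le_add_diff_inverse subsetD)
qed

text \<open>The prefixes of \<open>u\<close> form a chain of bounded length, so a longest one with
  property \<open>Q\<close> exists and has all the others as prefixes.\<close>

lemma longest_prefix_below:
  assumes "w \<in> X" and "prefix w u" and "Q w"
  obtains v where "v \<in> X" "prefix v u" "Q v" "prefix w v"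
    "\<And>v'. v' \<in> X \<Longrightarrow> prefix v' u \<Longrightarrow> Q v' \<Longrightarrow> prefix v' v"
proof -
  have "\<exists>v. (v \<in> X \<and> prefix v u \<and> Q v) \<and>
      (\<forall>v'. v' \<in> X \<and> prefix v' u \<and> Q v' \<longrightarrow> length v' \<le> length v)"
    by (rule ex_has_greatest_nat[of _ w _ "Suc (length u)"])
      (use assms in \<open>auto dest: prefix_length_le\<close>)
  then show thesis
    using that assms by (meson prefix_length_prefix)
qed

lemma shortest_prefix_below:
  assumes "w \<in> X" and "prefix w u" and "Q w"
  obtains v where "v \<in> X" "prefix v u" "Q v" "prefix v w"
    "\<And>v'. v' \<in> X \<Longrightarrow> prefix v' u \<Longrightarrow> Q v' \<Longrightarrow> prefix v v'"
proof -
  have "\<exists>v. (v \<in> X \<and> prefix v u \<and> Q v) \<and>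
      (\<forall>v'. v' \<in> X \<and> prefix v' u \<and> Q v' \<longrightarrow> length v \<le> length v')"
    by (rule ex_has_least_nat[of _ w]) (use assms in auto)
  then show thesis
    using that assms by (meson prefix_length_prefix)
qed

lemma covers_above:
  assumes "u \<in> X" "w \<in> X" "strict_prefix w u"
  obtains v where "(u, v) \<in> covers X" "prefix w v"
proof -
  obtain v where v: "v \<in> X" "prefix v u" "v \<noteq> u" "prefix w v"
    "\<And>v'. v' \<in> X \<Longrightarrow> prefix v' u \<Longrightarrow> v' \<noteq> u \<Longrightarrow> prefix v' v"
    using longest_prefix_below[of w X u "\<lambda>v. v \<noteq> u"] assms by (auto simp: strict_prefix_def)
  then have "(u, v) \<in> covers X"
    using assms by (auto simp: covers_def strict_prefix_def intro: prefix_order.antisym)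
  then show thesis using that v by blast
qed

lemma covers_below:
  assumes "u \<in> X" "w \<in> X" "strict_prefix w u"
  obtains v where "(v, w) \<in> covers X" "prefix v u"
proof -
  obtain v where v: "v \<in> X" "prefix v u" "strict_prefix w v"
    "\<And>v'. v' \<in> X \<Longrightarrow> prefix v' u \<Longrightarrow> strict_prefix w v' \<Longrightarrow> prefix v v'"
    using shortest_prefix_below[of u X u "\<lambda>v. strict_prefix w v"] assms by auto
  have "(v, w) \<in> covers X"
  proof -
    have False if "v' \<in> X" "strict_prefix w v'" "strict_prefix v' v" for v'
      using v(4)[of v'] that v(2)
      by (meson prefix_order.leD prefix_order.less_imp_le prefix_order.trans)
    then show ?thesis using v assms by (auto simp: covers_def)
  qed
  then show thesis using that v by blast
qed

text \<open>Climbing from parent to parent, every hop lowers the number of proper prefixes in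
  \<open>X\<close>. This crude bound serves the estimate in terms of the number of openings.\<close>

lemma hop_bound_covers:
  assumes "finite X"
  shows "hop_bound X (card X) (covers X)"
proof -
  have "(u, w) \<in> (covers X \<union> Id) ^^ card {v \<in> X. strict_prefix v u}"
    if "u \<in> X" "w \<in> X" "prefix w u" for u w
    using that
  proof (induction "length u" arbitrary: u rule: less_induct)
    case less
    show ?case
    proof (cases "u = w")
      case True
      then show ?thesis by (auto intro: relpow_Id_mono[where h = 0])
    next
      case False
      then have "strict_prefix w u" using less.prems by (simp add: strict_prefix_def)
      then obtain v where v: "(u, v) \<in> covers X" "prefix w v"
        using less.prems by (meson covers_above)
      then have vX: "v \<in> X" "strict_prefix v u" by (auto simp: covers_def)
      then have "(v, w) \<in> (covers X \<union> Id) ^^ card {x \<in> X. strict_prefix x v}"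
        using less v by (auto dest: prefix_length_less)
      then have "(u, w) \<in> (covers X \<union> Id) ^^ Suc (card {x \<in> X. strict_prefix x v})"
        using v by (blast intro: relpow_Suc_I2)
      moreover have "card {x \<in> X. strict_prefix x v} < card {x \<in> X. strict_prefix x u}"
      proof (rule psubset_card_mono)
        have "v \<in> {x \<in> X. strict_prefix x u} - {x \<in> X. strict_prefix x v}" using vX by simp
        moreover have "{x \<in> X. strict_prefix x v} \<subseteq> {x \<in> X. strict_prefix x u}"
          using vX(2) prefix_order.less_trans by blast
        ultimately show "{x \<in> X. strict_prefix x v} \<subset> {x \<in> X. strict_prefix x u}" by blast
      qed (use assms in simp)
      ultimately show ?thesis by (rule relpow_Id_mono[OF _ order_refl Suc_leI])
    qed
  qed
  moreover have "card {v \<in> X. strict_prefix v u} \<le> card X" for u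
    using assms by (intro card_mono) auto
  ultimately show ?thesis
    unfolding hop_bound_def by (blast intro: relpow_Id_mono)
qed

section \<open>Cut points, components and shortcuts\<close>

definition below :: "'a list set \<Rightarrow> 'a list set \<Rightarrow> 'a list \<Rightarrow> 'a list set" where
  "below X S v = {w \<in> X. prefix v w \<and> \<not> (\<exists>s\<in>S. prefix v s \<and> prefix s w)}"

text \<open>Greedy choice: a deepest node \<open>u\<close> with at least \<open>l\<close> nodes in
  its subtree becomes a cut point, its subtree is deleted, and the rest is treated recursively. Each
  cut point is paid for by \<open>l\<close> deleted nodes, and the nodes strictly below
  \<open>u\<close> have subtrees of fewer than \<open>l\<close> nodes by the choice of
  \<open>u\<close>.\<close>

lemma cut_set_exists:
  assumes "finite X" and "0 < l"
  shows "\<exists>S\<subseteq>X. card S * l \<le> card X \<and> (\<forall>v\<in>X. card (below X S v) < l)"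
  using assms(1)
proof (induction "card X" arbitrary: X rule: less_induct)
  case less
  define T where "T v = {w \<in> X. prefix v w}" for v
  show ?case
  proof (cases "\<forall>v\<in>X. card (T v) < l")
    case True
    then have "\<forall>v\<in>X. card (below X {} v) < l" by (simp add: below_def T_def)
    then show ?thesis by (intro exI[of _ "{}"]) simp
  next
    case False
    then obtain v0 where "v0 \<in> X" "l \<le> card (T v0)" by force
    then obtain u where u: "u \<in> X" "l \<le> card (T u)"
      and max: "\<And>v. v \<in> X \<Longrightarrow> l \<le> card (T v) \<Longrightarrow> length v \<le> length u"
      using ex_has_greatest_nat[of "\<lambda>v. v \<in> X \<and> l \<le> card (T v)" v0 length "Suc (Max (length ` X))"] less.prems
      by (auto simp: less_Suc_eq_le)
    have sub: "T u \<subseteq> X" and fin: "finite (T u)" using less.prems by (auto simp: T_def)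
    have "u \<in> T u" using u by (simp add: T_def)
    then have "card (X - T u) < card X"
      using less.prems u by (intro psubset_card_mono) auto
    then obtain S where S: "S \<subseteq> X - T u" "card S * l \<le> card (X - T u)"
      and small: "\<forall>v\<in>X - T u. card (below (X - T u) S v) < l"
      using less.hyps[of "X - T u"] less.prems by auto
    have "card (below X (insert u S) v) < l" if v: "v \<in> X" for v
    proof (cases "v \<in> T u")
      case True
      show ?thesis
      proof (cases "v = u")
        case True
        then have "below X (insert u S) v = {}" by (auto simp: below_def)
        then show ?thesis using assms(2) by simp
      next
        case False
        then have "length u < length v"
          using True by (auto simp: T_def strict_prefix_def intro!: prefix_length_less)
        then have "card (T v) < l" using max[of v] v by force
        moreover have "card (below X (insert u S) v) \<le> card (T v)"
          using less.prems by (intro card_mono) (auto simp: T_def below_def)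
        ultimately show ?thesis by simp
      qed
    next
      case False
      \<comment> \<open>Since \<open>u\<close> is not a prefix of \<open>v\<close>, a path from
        \<open>v\<close> down into the subtree of \<open>u\<close> would have to pass the cut point
        \<open>u\<close>.\<close>
      have "below X (insert u S) v \<subseteq> below (X - T u) S v"
        using False v prefix_same_cases[of v _ u]
        by (auto simp: below_def T_def)
      then have "card (below X (insert u S) v) \<le> card (below (X - T u) S v)"
        using less.prems by (intro card_mono) (auto simp: below_def)
      then show ?thesis using small v False by (meson DiffI le_less_trans)
    qed
    moreover have "card (insert u S) * l \<le> card X"
    proof -
      have "u \<notin> S" "finite S"
        using S \<open>u \<in> T u\<close> less.prems by (auto intro: finite_subset)
      then have "card (insert u S) * l = l + card S * l" by simp
      also have "\<dots> \<le> card (T u) + card (X - T u)" using u S by simp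
      also have "\<dots> = card X"
        using sub fin less.prems by (metis card_Diff_subset card_mono le_add_diff_inverse)
      finally show ?thesis .
    qed
    ultimately show ?thesis using u S by (intro exI[of _ "insert u S"]) auto
  qed
qed

text \<open>A node has at most one nearest cut point strictly above it, whence the bound on the
  number of shortcuts. The shortcut from \<open>u\<close> is the edge to its parent, followed by the
  shortcut of the parent unless the parent is the cut point; hence the ranking by length.\<close>

lemma shortcuts_up:
  assumes "finite X" "S \<subseteq> X"
  defines "U \<equiv> {(u, s). u \<in> X \<and> s \<in> S \<and> strict_prefix s u \<and>
                  \<not> (\<exists>t\<in>S. strict_prefix s t \<and> strict_prefix t u)}"
  shows "trcl_steps (covers X) (card X) (covers X \<union> U)"
proof -
  have inj: "inj_on fst U"
  proof (rule inj_onI, clarsimp simp: U_def)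
    fix u s t
    assume "s \<in> S" "t \<in> S" "strict_prefix s u" "strict_prefix t u"
      "\<forall>t\<in>S. strict_prefix s t \<longrightarrow> \<not> strict_prefix t u"
      "\<forall>s\<in>S. strict_prefix t s \<longrightarrow> \<not> strict_prefix s u"
    then show "s = t"
      by (metis prefix_same_cases strict_prefix_def)
  qed
  have "finite (X \<times> X)" using assms by simp
  then have fin: "finite U"
    by (rule rev_finite_subset) (use assms in \<open>auto simp: U_def\<close>)
  have "card U = card (fst ` U)" using inj by (simp add: card_image)
  also have "\<dots> \<le> card X" by (rule card_mono) (use assms in \<open>auto simp: U_def\<close>)
  finally have card: "card U \<le> card X" .
  have "trcl_steps (covers X) (card U) (covers X \<union> U)"
  proof (rule trcl_steps_ranked[where rank = "\<lambda>(u, s). length u"])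
    fix u s assume us: "(u, s) \<in> U"
    then have "u \<in> X" "s \<in> X" "s \<in> S" "strict_prefix s u" using assms by (auto simp: U_def)
    then obtain v where v: "(u, v) \<in> covers X" "prefix s v" by (meson covers_above)
    then have vX: "v \<in> X" "strict_prefix v u" by (auto simp: covers_def)
    show "(u, s) \<in> covers X \<or>
      (\<exists>v. ((u, v) \<in> covers X \<or> (u, v) \<in> U \<and> (case (u, v) of (u, s) \<Rightarrow> length u) < (case (u, s) of (u, s) \<Rightarrow> length u)) \<and>
           ((v, s) \<in> covers X \<or> (v, s) \<in> U \<and> (case (v, s) of (u, s) \<Rightarrow> length u) < (case (u, s) of (u, s) \<Rightarrow> length u)))"
    proof (cases "v = s")
      case False
      then have "(v, s) \<in> U"
        using us v vX by (auto simp: U_def strict_prefix_def dest: prefix_order.trans)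
      then show ?thesis using v vX by (auto dest: prefix_length_less)
    qed (use v in simp)
  qed (rule fin)
  then show ?thesis using card by (rule trcl_steps_mono)
qed

text \<open>The targets of a cut point \<open>s\<close> lie on one path, strictly between
  \<open>s\<close> and the next cut point above. With \<open>v\<close> the topmost target, they all
  belong to \<open>below X S v\<close>, so there are fewer than \<open>l\<close> of them. They are
  reached in order of distance from \<open>s\<close>, the last hop being a parent edge.\<close>

lemma shortcuts_down:
  assumes "finite X" "S \<subseteq> X" and small: "\<And>v. v \<in> X \<Longrightarrow> card (below X S v) < l" 
  defines "D \<equiv> {(s, w). s \<in> S \<and> w \<in> X \<and> strict_prefix w s \<and>
                  \<not> (\<exists>t\<in>S. prefix w t \<and> strict_prefix t s)}"
  shows "trcl_steps (covers X) (card S * l) (covers X \<union> D)"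
proof -
  have finS: "finite S" using assms finite_subset by blast
  have le: "card {w. (s, w) \<in> D} \<le> l" if s: "s \<in> S" for s
  proof (cases "{w. (s, w) \<in> D} = {}")
    case False
    then obtain w where "(s, w) \<in> D" by auto
    moreover have XD: "v \<in> X" "prefix v s" if "(s, v) \<in> D" for v
      using that by (auto simp: D_def strict_prefix_def)
    ultimately obtain v where v: "(s, v) \<in> D" "\<And>v'. (s, v') \<in> D \<Longrightarrow> prefix v v'"
      using shortest_prefix_below[of w X s "\<lambda>v. (s, v) \<in> D"] by metis
    have "{w. (s, w) \<in> D} \<subseteq> below X S v"
    proof safe
      fix w assume w: "(s, w) \<in> D"
      then have "prefix v w" using v(2) by blast
      moreover have "\<not> (\<exists>t\<in>S. prefix v t \<and> prefix t w)"
      proof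
        assume "\<exists>t\<in>S. prefix v t \<and> prefix t w"
        then obtain t where t: "t \<in> S" "prefix v t" "prefix t w" by blast
        then have "strict_prefix t s" using w
          by (auto simp: D_def intro: prefix_order.le_less_trans)
        then show False using v(1) t by (auto simp: D_def)
      qed
      ultimately show "w \<in> below X S v" using w by (auto simp: below_def D_def)
    qed
    then have "card {w. (s, w) \<in> D} \<le> card (below X S v)"
      by (intro card_mono) (use assms(1) in \<open>auto simp: below_def\<close>)
    also have "\<dots> < l" using small v(1) by (auto simp: D_def)
    finally show ?thesis by simp
  qed (simp only: card.empty)
  have fin: "finite {w. (s, w) \<in> D}" for s
    by (rule finite_subset[OF _ assms(1)]) (auto simp: D_def)
  have Deq: "D = Sigma S (\<lambda>s. {w. (s, w) \<in> D})" by (auto simp: D_def)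
  have finD: "finite D" by (subst Deq) (use finS fin in auto)
  have "card D = (\<Sum>s\<in>S. card {w. (s, w) \<in> D})"
    by (subst Deq, rule card_SigmaI) (use finS fin in auto)
  also have "\<dots> \<le> card S * l" using sum_mono[of S "\<lambda>s. card {w. (s, w) \<in> D}" "\<lambda>_. l"] le by simp
  finally have card: "card D \<le> card S * l" .
  have "trcl_steps (covers X) (card D) (covers X \<union> D)"
  proof (rule trcl_steps_ranked[where rank = "\<lambda>(s, w). length s - length w"])
    fix s w assume sw: "(s, w) \<in> D"
    then have "s \<in> X" "w \<in> X" "s \<in> S" "strict_prefix w s" using assms by (auto simp: D_def)
    then obtain v where v: "(v, w) \<in> covers X" "prefix v s" by (meson covers_below)
    then have vX: "v \<in> X" "strict_prefix w v" by (auto simp: covers_def)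
    show "(s, w) \<in> covers X \<or>
      (\<exists>v. ((s, v) \<in> covers X \<or> (s, v) \<in> D \<and> (case (s, v) of (s, w) \<Rightarrow> length s - length w) < (case (s, w) of (s, w) \<Rightarrow> length s - length w)) \<and>
           ((v, w) \<in> covers X \<or> (v, w) \<in> D \<and> (case (v, w) of (s, w) \<Rightarrow> length s - length w) < (case (s, w) of (s, w) \<Rightarrow> length s - length w)))"
    proof (cases "v = s")
      case False
      then have "(s, v) \<in> D"
        using sw v vX by (auto simp: D_def strict_prefix_def dest: prefix_order.trans)
      moreover have "length w < length v" "length v \<le> length s"
        using vX v by (auto dest: prefix_length_less prefix_length_le)
      ultimately show ?thesis using v vX by auto
    qed (use v in simp)
  qed (rule finD)
  then show ?thesis using card by (rule trcl_steps_mono)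
qed

text \<open>Components are convex: a node between two nodes of a component lies in it. So shortcuts
  built inside a component start from parent edges of the whole forest.\<close>

lemma covers_below_subset:
  assumes "r \<in> X" "S \<subseteq> X"
  shows "covers (below X S r) \<subseteq> covers X"
proof safe
  fix u w assume uw: "(u, w) \<in> covers (below X S r)"
  have False if x: "x \<in> X" "strict_prefix w x" "strict_prefix x u" for x
  proof -
    have "x \<in> below X S r" using x uw
      by (auto simp: covers_def below_def strict_prefix_def dest: prefix_order.trans)
    then show False using x uw by (auto simp: covers_def)
  qed
  then show "(u, w) \<in> covers X" using uw by (auto simp: covers_def below_def)
qed

text \<open>
  A path from \<open>u\<close> up to \<open>w\<close> that meets a cut point makes one hop to the first cut point, travels
  among the cut points by the shortcuts \<open>E\<^sub>0\<close>, and makes one hop from the last cut point to \<open>w\<close>;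
  any other path stays inside one component of \<open>X - S\<close>, namely \<open>below X S r\<close> for its topmost
  element \<open>r\<close>.
\<close>

lemma shortcuts_combine:
  assumes X: "finite X" and S: "S \<subseteq> X" "card S * l \<le> card X"
    and small: "\<And>v. v \<in> X \<Longrightarrow> card (below X S v) < l"
    and top: "trcl_steps (covers S) p E\<^sub>0" "hop_bound S h E\<^sub>0"
    and comp: "\<And>Y. Y \<subseteq> X \<Longrightarrow> card Y < l \<Longrightarrow>
      \<exists>E. trcl_steps (covers Y) (q * card Y) E \<and> hop_bound Y (h + 2) E"
  shows "\<exists>E. trcl_steps (covers X) (2 * card X + p + q * card X) E \<and> hop_bound X (h + 2) E"
proof -
  define U where "U = {(u, s). u \<in> X \<and> s \<in> S \<and> strict_prefix s u \<and>
                  \<not> (\<exists>t\<in>S. strict_prefix s t \<and> strict_prefix t u)}"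
  define D where "D = {(s, w). s \<in> S \<and> w \<in> X \<and> strict_prefix w s \<and>
                  \<not> (\<exists>t\<in>S. prefix w t \<and> strict_prefix t s)}"
  define R where "R = {r \<in> X - S. \<forall>w\<in>X. strict_prefix w r \<longrightarrow> (\<exists>s\<in>S. prefix w s \<and> prefix s r)}"
  have finR: "finite R" using X by (simp add: R_def)
  have "\<forall>r\<in>R. \<exists>E. trcl_steps (covers (below X S r)) (q * card (below X S r)) E \<and>
          hop_bound (below X S r) (h + 2) E"
    using comp small by (auto simp: R_def below_def)
  then obtain E where E: "\<And>r. r \<in> R \<Longrightarrow> trcl_steps (covers (below X S r)) (q * card (below X S r)) (E r)"
    "\<And>r. r \<in> R \<Longrightarrow> hop_bound (below X S r) (h + 2) (E r)" by metis
  define F where "F = covers X \<union> U \<union> D \<union> E\<^sub>0 \<union> (\<Union>r\<in>R. E r)"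

  \<comment> \<open>The tops of two components with a common node would be comparable, and then a
    cut point would separate the upper top from the lower one, hence from the common node.\<close>
  have disj: "below X S r \<inter> below X S r' = {}" if R: "r \<in> R" "r' \<in> R" "r \<noteq> r'" for r r'
  proof -
    have False if v: "v \<in> below X S r" "v \<in> below X S r'" and R: "r \<in> R" "r' \<in> R" "strict_prefix r r'" for v r r'
    proof -
      obtain s where "s \<in> S" "prefix r s" "prefix s r'" using R by (auto simp: R_def)
      then show False using v by (auto simp: below_def dest: prefix_order.trans)
    qed
    moreover have "strict_prefix r r' \<or> strict_prefix r' r" if "v \<in> below X S r" "v \<in> below X S r'" for v
      using that R(3) prefix_same_cases[of r v r'] by (auto simp: below_def strict_prefix_def)
    ultimately show ?thesis using R by blast
  qed
  have "(\<Sum>r\<in>R. card (below X S r)) = card (\<Union>r\<in>R. below X S r)"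
    using disj finR X by (intro card_UN_disjoint[symmetric]) (auto simp: below_def)
  also have "\<dots> \<le> card X" using X by (intro card_mono) (auto simp: below_def)
  finally have sumR: "(\<Sum>r\<in>R. q * card (below X S r)) \<le> q * card X"
    by (simp flip: sum_distrib_left)

  have "trcl_steps (covers X) (card X + card S * l) ((covers X \<union> U) \<union> (covers X \<union> D))"
    unfolding U_def D_def
    using shortcuts_up[OF X S(1)] shortcuts_down[OF X S(1) small] by (rule trcl_steps_extend) auto
  \<comment> \<open>The parent edges of the forest of cut points are themselves shortcuts in
    \<open>U\<close>, so \<open>E\<^sub>0\<close> can be built on top of them.\<close>
  then have "trcl_steps (covers X) (card X + card S * l + p)
      (((covers X \<union> U) \<union> (covers X \<union> D)) \<union> E\<^sub>0)"
    using top(1) by (rule trcl_steps_extend) (use S in \<open>auto simp: covers_def U_def\<close>)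
  moreover have "trcl_steps (covers X) (\<Sum>r\<in>R. q * card (below X S r)) (covers X \<union> (\<Union>r\<in>R. E r))"
    using finR E(1) by (rule trcl_steps_UN) (use S covers_below_subset R_def in blast)+
  ultimately have "trcl_steps (covers X) (card X + card S * l + p + (\<Sum>r\<in>R. q * card (below X S r)))
      ((((covers X \<union> U) \<union> (covers X \<union> D)) \<union> E\<^sub>0) \<union> (covers X \<union> (\<Union>r\<in>R. E r)))"
    by (rule trcl_steps_extend) auto
  moreover have "((((covers X \<union> U) \<union> (covers X \<union> D)) \<union> E\<^sub>0) \<union> (covers X \<union> (\<Union>r\<in>R. E r))) = F"
    by (auto simp: F_def)
  \<comment> \<open>One \<open>card X\<close> pays for \<open>U\<close>; the other pays for
    \<open>D\<close>, as \<open>card S * l \<le> card X\<close>.\<close>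
  ultimately have steps: "trcl_steps (covers X) (2 * card X + p + q * card X) F"
    using S(2) sumR by (auto elim!: trcl_steps_mono)

  have "(u, w) \<in> (F \<union> Id) ^^ (h + 2)" if uw: "u \<in> X" "w \<in> X" "prefix w u" for u w
  proof (cases "\<exists>s\<in>S. prefix w s \<and> prefix s u")
    case True
    then obtain s where s: "s \<in> S" "prefix w s" "prefix s u" by blast
    obtain s1 where s1: "s1 \<in> S" "prefix s1 u" "prefix s s1"
      "\<And>t. t \<in> S \<Longrightarrow> prefix t u \<Longrightarrow> prefix t s1"
      using longest_prefix_below[of s S u "\<lambda>_. True"] s by metis
    obtain s2 where s2: "s2 \<in> S" "prefix s2 u" "prefix w s2" "prefix s2 s"
      "\<And>t. t \<in> S \<Longrightarrow> prefix t u \<Longrightarrow> prefix w t \<Longrightarrow> prefix s2 t"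
      using shortest_prefix_below[of s S u "prefix w"] s by metis
    have "(u, s1) \<in> F \<union> Id"
      using uw s1 by (auto simp: F_def U_def strict_prefix_def intro: prefix_order.antisym)
    moreover have "(s1, s2) \<in> (E\<^sub>0 \<union> Id) ^^ h"
      using top(2) s1 s2 by (auto simp: hop_bound_def)
    then have "(s1, s2) \<in> (F \<union> Id) ^^ h"
      by (rule relpow_Id_mono) (auto simp: F_def)
    moreover have "(s2, w) \<in> F \<union> Id"
      using uw s2 by (auto simp: F_def D_def strict_prefix_def dest: prefix_order.antisym prefix_order.trans)
    ultimately have "(u, w) \<in> (F \<union> Id) ^^ Suc (Suc h)"
      by (meson relpow_Suc_I relpow_Suc_I2)
    then show ?thesis by simp
  next
    case False
    obtain r where r: "r \<in> X" "prefix r u" "\<not> (\<exists>s\<in>S. prefix r s \<and> prefix s u)" "prefix r w"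
      "\<And>v. v \<in> X \<Longrightarrow> prefix v u \<Longrightarrow> \<not> (\<exists>s\<in>S. prefix v s \<and> prefix s u) \<Longrightarrow> prefix r v"
      using shortest_prefix_below[of w X u "\<lambda>v. \<not> (\<exists>s\<in>S. prefix v s \<and> prefix s u)"] uw False by metis
    have "r \<in> R"
    proof -
      have "\<exists>s\<in>S. prefix v s \<and> prefix s r" if v: "v \<in> X" "strict_prefix v r" for v
      proof -
        have "prefix v u" "\<not> prefix r v"
          using v r(2) by (auto simp: strict_prefix_def dest: prefix_order.trans prefix_order.antisym)
        then obtain s where "s \<in> S" "prefix v s" "prefix s u" using r(5) v by blast
        then show ?thesis using r(2,3) prefix_same_cases by blast
      qed
      then show ?thesis using r(1-3) by (auto simp: R_def)
    qed
    moreover have "u \<in> below X S r" "w \<in> below X S r"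
      using r uw by (auto simp: below_def dest: prefix_order.trans)
    ultimately have "(u, w) \<in> (E r \<union> Id) ^^ (h + 2)"
      using E(2) uw by (auto simp: hop_bound_def)
    then show ?thesis
      by (rule relpow_Id_mono) (use \<open>r \<in> R\<close> in \<open>auto simp: F_def\<close>)
  qed
  then have "hop_bound X (h + 2) F" unfolding hop_bound_def by blast
  then show ?thesis using steps by blast
qed

subsection \<open>The Ackermann hierarchy\<close>

lemma ackermann_less: "0 < m \<or> 0 < k \<Longrightarrow> m < ackermann k m"
proof (induction k m rule: ackermann.induct)
  case (3 k m)
  then have "m < ackermann (Suc k) m" by simp
  moreover have "ackermann (Suc k) m < ackermann k (ackermann (Suc k) m)"
    using 3 by (metis \<open>m < ackermann (Suc k) m\<close> gr_zeroI not_less_zero)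
  ultimately show ?case by simp
qed auto

lemma ackermann_Suc_pos: "0 < ackermann (Suc k) m"
  using ackermann_less[of m "Suc k"] by simp

lemma ackermann_strict_mono: "m < m' \<Longrightarrow> ackermann k m < ackermann k m'"
proof (induction m' arbitrary: m)
  case (Suc m')
  have "ackermann k m' < ackermann k (Suc m')"
    by (cases k) (auto simp: ackermann_Suc_pos intro!: ackermann_less)
  then show ?case
    using Suc by (metis less_SucE order.strict_trans)
qed simp

lemma ackermann_mono: "m \<le> m' \<Longrightarrow> ackermann k m \<le> ackermann k m'"
  using ackermann_strict_mono[of m m' k] by (auto simp: le_less)

text \<open>All levels agree at argument 2, so 3 is the least argument at which the hierarchy grows
  without bound in the level.\<close>

lemma ackermann_2: "ackermann k 2 = 4"
proof (induction k)
  case (Suc k)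
  have "ackermann (Suc k) 1 = 2"
    by (induction k) (auto simp: numeral_2_eq_2)
  then show ?case using Suc by (simp add: numeral_2_eq_2)
qed simp

text \<open>Two more levels replace the diagonal argument by the constant 3, which makes the factor
  \<open>j\<close> in the number of shortcuts constant. The right side unfolds to
  \<open>ackermann i (ackermann (i + 1) 3)\<close>, whose inner value is at least
  \<open>i\<close>.\<close>

lemma ackermann_diagonal_le: "ackermann i i \<le> ackermann (i + 2) 3"
proof -
  have 3: "ackermann (Suc k) 3 = ackermann k 4" for k
    using ackermann_2[of "Suc k"] by (simp add: numeral_3_eq_3 numeral_2_eq_2)
  have 4: "ackermann (Suc k) 4 = ackermann k (ackermann (Suc k) 3)" for k
    by (simp add: eval_nat_numeral)
  have "k \<le> ackermann k 3" for k
  proof (induction k)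
    case (Suc k)
    have "ackermann k 3 < ackermann k 4" by (rule ackermann_strict_mono) simp
    then show ?case using Suc 3[of k] by simp
  qed simp
  then have "i \<le> ackermann (Suc i) 3" by (meson Suc_leD)
  then have "ackermann i i \<le> ackermann i (ackermann (Suc i) 3)" by (rule ackermann_mono)
  then show ?thesis by (simp add: 3 4)
qed

lemma less_ackermann_inv_ackermann: "n < ackermann (inv_ackermann n) (inv_ackermann n)"
  unfolding inv_ackermann_def
proof (rule LeastI)
  show "n < ackermann (Suc n) (Suc n)"
    using ackermann_less[of "Suc n" "Suc n"] by linarith
qed

lemma inv_ackermann_pos: "0 < inv_ackermann n"
proof (rule ccontr)
  assume "\<not> 0 < inv_ackermann n"
  then show False using less_ackermann_inv_ackermann[of n] by simp
qed

text \<open>At level 0 all pairs are joined directly, and for \<open>j = 0\<close> at a positive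
  level there is at most one node. Otherwise cut with \<open>l = ackermann (Suc k) j\<close>: the
  components fall under \<open>(Suc k, j)\<close>, the forest of cut points under
  \<open>(k, l)\<close>. The large factor \<open>l\<close> in the cost of the latter is absorbed by
  \<open>card S * l \<le> card X\<close>, and two hops are added.\<close>

lemma ackermann_shortcuts:
  assumes "finite X" and "card X \<le> ackermann k j"
  shows "\<exists>E. trcl_steps (covers X) (2 * (k + 1) * j * card X) E \<and> hop_bound X (2 * k + 1) E"
  using assms
proof (induction k j arbitrary: X rule: ackermann.induct)
  case (1 j)
  define D where "D = {(u, w). u \<in> X \<and> w \<in> X \<and> strict_prefix w u}"
  have sub: "D \<subseteq> X \<times> X" by (auto simp: D_def)
  then have fin: "finite D" using 1 by (meson finite_SigmaI finite_subset)
  have "card D \<le> card (X \<times> X)" using sub 1 by (intro card_mono) auto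
  also have "\<dots> \<le> 2 * j * card X" using 1 by simp
  finally have card: "card D \<le> 2 * j * card X" .
  have "trcl_steps (covers X) (card D) (covers X \<union> D)"
  proof (rule trcl_steps_ranked[where rank = "\<lambda>(u, s). length u"])
    fix u w assume uw: "(u, w) \<in> D"
    then have "u \<in> X" "w \<in> X" "strict_prefix w u" by (auto simp: D_def)
    then obtain v where v: "(u, v) \<in> covers X" "prefix w v" by (meson covers_above)
    then have vX: "v \<in> X" "strict_prefix v u" by (auto simp: covers_def)
    then have "v = w \<or> (v, w) \<in> D \<and> length v < length u"
      using v \<open>w \<in> X\<close> by (auto simp: D_def strict_prefix_def[of w v] dest: prefix_length_less)
    then show "(u, w) \<in> covers X \<or>
      (\<exists>v. ((u, v) \<in> covers X \<or> (u, v) \<in> D \<and> (case (u, v) of (u, s) \<Rightarrow> length u) < (case (u, w) of (u, s) \<Rightarrow> length u)) \<and>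
           ((v, w) \<in> covers X \<or> (v, w) \<in> D \<and> (case (v, w) of (u, s) \<Rightarrow> length u) < (case (u, w) of (u, s) \<Rightarrow> length u)))"
      using v by auto
  qed (rule fin)
  then have "trcl_steps (covers X) (2 * j * card X) (covers X \<union> D)"
    using card by (rule trcl_steps_mono)
  moreover have "hop_bound X 1 (covers X \<union> D)"
    by (auto simp: hop_bound_def D_def strict_prefix_def)
  ultimately show ?case by auto
next
  case (2 k)
  then have "u = w" if "u \<in> X" "w \<in> X" for u w
    using that by (simp add: card_le_Suc0_iff_eq)
  then have "hop_bound X (2 * Suc k + 1) (covers X)"
    by (fastforce simp: hop_bound_def intro: relpow_Id_mono[where h = 0])
  then show ?case by (auto intro: trcl_steps.base)
next
  case (3 k j)
  let ?l = "ackermann (Suc k) j"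
  obtain S where S: "S \<subseteq> X" "card S * ?l \<le> card X" "\<forall>v\<in>X. card (below X S v) < ?l"
    using cut_set_exists[OF 3(3) ackermann_Suc_pos] by blast
  have "card S \<le> ackermann k ?l"
    using S(1) 3(3,4) by (metis ackermann.simps(3) card_mono le_trans)
  then obtain E\<^sub>0 where E0: "trcl_steps (covers S) (2 * (k + 1) * ?l * card S) E\<^sub>0"
    "hop_bound S (2 * k + 1) E\<^sub>0"
    using 3(2)[of S] S(1) 3(3) finite_subset by blast
  have "\<exists>E. trcl_steps (covers X) (2 * card X + 2 * (k + 1) * ?l * card S + 2 * (Suc k + 1) * j * card X) E \<and>
      hop_bound X (2 * k + 1 + 2) E"
  proof (rule shortcuts_combine[OF 3(3) S(1,2) _ E0])
    fix Y assume Y: "Y \<subseteq> X" "card Y < ?l"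
    then show "\<exists>E. trcl_steps (covers Y) (2 * (Suc k + 1) * j * card Y) E \<and> hop_bound Y (2 * k + 1 + 2) E"
      using 3(1)[of Y] 3(3) finite_subset by auto
  qed (use S in auto)
  \<comment> \<open>With \<open>N = card X\<close> the three costs add up to at most
    \<open>2 N + 2 (k + 1) N + 2 (k + 2) j N = 2 (k + 2) (j + 1) N\<close>.\<close>
  moreover have "2 * card X + 2 * (k + 1) * ?l * card S + 2 * (Suc k + 1) * j * card X
      \<le> 2 * (Suc k + 1) * Suc j * card X"
  proof -
    have "2 * (k + 1) * (card S * ?l) \<le> 2 * (k + 1) * card X"
      using S(2) by (rule mult_le_mono2)
    then show ?thesis by (simp add: algebra_simps)
  qed
  ultimately obtain E where "trcl_steps (covers X) (2 * (Suc k + 1) * Suc j * card X) E"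
    "hop_bound X (2 * k + 1 + 2) E"
    using trcl_steps_mono by blast
  then show ?case by (auto simp: algebra_simps)
qed

subsection \<open>Derived rules of three-valued logic\<close>

inductive prv :: "fm set \<Rightarrow> fm \<Rightarrow> bool" for H where
  hyp: "A \<in> H \<Longrightarrow> prv H A"
| ax: "luk_axiom A \<Longrightarrow> prv H A"
| mp: "prv H A \<Longrightarrow> prv H (A \<^bold>\<supset> B) \<Longrightarrow> prv H B"

lemma prv_mono: "prv H A \<Longrightarrow> H \<subseteq> H' \<Longrightarrow> prv H' A"
  by (induction rule: prv.induct) (auto intro: prv.intros)

lemma prv_K: "prv H A \<Longrightarrow> prv H (B \<^bold>\<supset> A)"
  by (meson luk_axiom.intros prv.intros)

lemma prv_trans: "prv H (A \<^bold>\<supset> B) \<Longrightarrow> prv H (B \<^bold>\<supset> C) \<Longrightarrow> prv H (A \<^bold>\<supset> C)"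
  by (meson luk_axiom.intros(2) prv.intros)

lemma prv_antimono: "prv H (A \<^bold>\<supset> B) \<Longrightarrow> prv H ((B \<^bold>\<supset> C) \<^bold>\<supset> (A \<^bold>\<supset> C))"
  by (meson luk_axiom.intros(2) prv.intros)

text \<open>Schema (1) gives the formula with \<open>(B \<supset> A) \<supset> A\<close> on the
  right, and schema (3) exchanges \<open>A\<close> and \<open>B\<close> there.\<close>

lemma prv_assertion: "prv H (A \<^bold>\<supset> ((A \<^bold>\<supset> B) \<^bold>\<supset> B))"
  by (rule prv_trans[of _ _ "(B \<^bold>\<supset> A) \<^bold>\<supset> A"]) (auto intro: prv.ax luk_axiom.intros)

text \<open>For want of contraction, pass through a theorem \<open>?T\<close>: \<open>A\<close>
  implies \<open>?T \<supset> A\<close>, which implies \<open>A\<close> by assertion.\<close>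

lemma prv_refl: "prv H (A \<^bold>\<supset> A)"
proof -
  let ?T = "A \<^bold>\<supset> (A \<^bold>\<supset> A)"
  have "prv H ?T" by (intro prv.ax luk_axiom.intros)
  then have "prv H ((?T \<^bold>\<supset> A) \<^bold>\<supset> A)" by (rule prv.mp[OF _ prv_assertion])
  moreover have "prv H (A \<^bold>\<supset> (?T \<^bold>\<supset> A))" by (intro prv.ax luk_axiom.intros)
  ultimately show ?thesis by (blast intro: prv_trans)
qed

text \<open>Schema (2) yields
  \<open>((B \<supset> C) \<supset> C) \<supset> (A \<supset> C)\<close>, and \<open>B\<close>
  implies the premise of this by assertion.\<close>

lemma prv_exchange_thm: "prv H ((A \<^bold>\<supset> (B \<^bold>\<supset> C)) \<^bold>\<supset> (B \<^bold>\<supset> (A \<^bold>\<supset> C)))"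
  by (rule prv_trans[OF prv.ax[OF luk_axiom.intros(2)] prv_antimono[OF prv_assertion]])

lemma prv_exchange: "prv H (A \<^bold>\<supset> (B \<^bold>\<supset> C)) \<Longrightarrow> prv H (B \<^bold>\<supset> (A \<^bold>\<supset> C))"
  by (rule prv.mp[OF _ prv_exchange_thm])

lemma prv_imp_mono: "prv H (B \<^bold>\<supset> C) \<Longrightarrow> prv H ((A \<^bold>\<supset> B) \<^bold>\<supset> (A \<^bold>\<supset> C))"
  by (rule prv.mp[OF _ prv_exchange[OF prv.ax[OF luk_axiom.intros(2)]]])

text \<open>The formula \<open>(X \<supset> Y) \<supset> Y\<close> is the join of \<open>X\<close>
  and \<open>Y\<close>: enlarge \<open>X\<close> to \<open>Z\<close> in it, swap the two by schema
  (3), and detach the provable \<open>Y \<supset> Z\<close>.\<close>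

lemma prv_join_le:
  assumes "prv H (X \<^bold>\<supset> Z)" and "prv H (Y \<^bold>\<supset> Z)"
  shows "prv H (((X \<^bold>\<supset> Y) \<^bold>\<supset> Y) \<^bold>\<supset> Z)"
proof -
  have "prv H (((X \<^bold>\<supset> Y) \<^bold>\<supset> Y) \<^bold>\<supset> ((Z \<^bold>\<supset> Y) \<^bold>\<supset> Y))"
    by (intro prv_antimono assms(1))
  moreover have "prv H (((Z \<^bold>\<supset> Y) \<^bold>\<supset> Y) \<^bold>\<supset> ((Y \<^bold>\<supset> Z) \<^bold>\<supset> Z))"
    by (intro prv.ax luk_axiom.intros)
  moreover have "prv H (((Y \<^bold>\<supset> Z) \<^bold>\<supset> Z) \<^bold>\<supset> Z)"
    by (rule prv.mp[OF assms(2) prv_assertion])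
  ultimately show ?thesis
    by (blast intro: prv_trans)
qed

text \<open>
  With the join \<open>X \<squnion> Y = (X \<supset> Y) \<supset> Y\<close>, axiom schema (4) reads
  \<open>A \<squnion> (A \<supset> B) \<squnion> (B \<supset> C)\<close>.
\<close>

lemma prv_three_cases:
  assumes "prv H (A \<^bold>\<supset> Z)" and "prv H ((A \<^bold>\<supset> B) \<^bold>\<supset> Z)" and "prv H ((B \<^bold>\<supset> C) \<^bold>\<supset> Z)"
  shows "prv H Z"
  by (rule prv.mp[OF prv.ax[OF luk_axiom.intros(4)]
        prv_join_le[OF prv_join_le[OF assms(2) assms(1)] assms(3)]])

text \<open>Split into the cases \<open>z\<close>, \<open>z \<supset> (A \<supset> B)\<close> and
  \<open>(A \<supset> B) \<supset> B\<close>. In the second, chaining with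
  \<open>A \<supset> z\<close> gives \<open>A \<supset> (A \<supset> B)\<close>, which is
  \<open>z\<close>; the third is the join of \<open>A\<close> and \<open>B\<close>, both of which
  imply \<open>z\<close>.\<close>

lemma prv_contraction:
  assumes "prv H (A \<^bold>\<supset> (A \<^bold>\<supset> (A \<^bold>\<supset> B)))"
  shows "prv H (A \<^bold>\<supset> (A \<^bold>\<supset> B))"
proof -
  define z where "z = (A \<^bold>\<supset> (A \<^bold>\<supset> B))"
  have Az: "prv H (A \<^bold>\<supset> z)"
    using assms by (simp add: z_def)
  have "prv H (B \<^bold>\<supset> z)"
    unfolding z_def by (rule prv_trans[of _ _ "A \<^bold>\<supset> B"]; intro prv.ax luk_axiom.intros)
  then have "prv H (((A \<^bold>\<supset> B) \<^bold>\<supset> B) \<^bold>\<supset> z)"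
    by (rule prv_join_le[OF Az])
  moreover have "prv H ((z \<^bold>\<supset> (A \<^bold>\<supset> B)) \<^bold>\<supset> z)"
    using prv_antimono[OF Az] by (simp add: z_def)
  ultimately have "prv H z"
    using prv_three_cases[OF prv_refl[of H z]] by blast
  then show ?thesis by (simp add: z_def)
qed

text \<open>Exchange collects four premises \<open>G\<close>, two from each hypothesis, and
  contraction brings them back to two.\<close>

lemma prv_mp_double:
  assumes "prv H (G \<^bold>\<supset> (G \<^bold>\<supset> C))" and "prv H (G \<^bold>\<supset> (G \<^bold>\<supset> (C \<^bold>\<supset> B)))"
  shows "prv H (G \<^bold>\<supset> (G \<^bold>\<supset> B))"
proof -
  have "prv H (G \<^bold>\<supset> (C \<^bold>\<supset> (G \<^bold>\<supset> B)))"
    using assms(2) prv_exchange_thm by (rule prv_trans)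
  then have "prv H (C \<^bold>\<supset> (G \<^bold>\<supset> (G \<^bold>\<supset> B)))"
    by (rule prv_exchange)
  then have "prv H ((G \<^bold>\<supset> C) \<^bold>\<supset> (G \<^bold>\<supset> (G \<^bold>\<supset> (G \<^bold>\<supset> B))))"
    by (rule prv_imp_mono)
  then have "prv H (G \<^bold>\<supset> (G \<^bold>\<supset> (G \<^bold>\<supset> (G \<^bold>\<supset> B))))"
    by (rule prv_trans[OF assms(1)])
  then show ?thesis
    by (rule prv_contraction[OF prv_contraction])
qed

lemma prv_deduction:
  assumes "prv (insert G H) A"
  shows "prv H (G \<^bold>\<supset> (G \<^bold>\<supset> A))"
  using assms
proof (induction rule: prv.induct)
  case (hyp A)
  then show ?case
    using prv_K[OF prv_K[OF prv.hyp]] prv.ax[OF luk_axiom.intros(1)] by blast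
next
  case (ax A)
  then show ?case by (intro prv_K prv.ax)
next
  case (mp A B)
  show ?case by (rule prv_mp_double[OF mp.IH])
qed

text \<open>First \<open>A \<supset> (B \<supset> C)\<close> is proved without the disjunction, by
  the cases \<open>A\<close>, \<open>A \<supset> (B \<supset> C)\<close> and
  \<open>(B \<supset> C) \<supset> C\<close>, the last being the join of \<open>B\<close> and
  \<open>C\<close>. Then the disjunction is used three times through schema (10), to get
  \<open>A \<supset> C\<close>, \<open>B \<supset> C\<close> and finally \<open>C\<close>.\<close>

lemma prv_or_elim:
  assumes "prv H (A \<^bold>\<or> B)" and A: "prv H (A \<^bold>\<supset> (A \<^bold>\<supset> C))" and B: "prv H (B \<^bold>\<supset> (B \<^bold>\<supset> C))"
  shows "prv H C"
proof -
  define z where "z = (A \<^bold>\<supset> (B \<^bold>\<supset> C))"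
  have K: "prv H (C \<^bold>\<supset> (B \<^bold>\<supset> C))" "prv H ((B \<^bold>\<supset> C) \<^bold>\<supset> z)"
    unfolding z_def by (intro prv.ax luk_axiom.intros)+
  have Az: "prv H (A \<^bold>\<supset> z)"
    unfolding z_def by (rule prv_trans[OF A prv_imp_mono[OF K(1)]])
  have "prv H (((B \<^bold>\<supset> C) \<^bold>\<supset> C) \<^bold>\<supset> z)"
    by (rule prv_join_le[OF prv_trans[OF B K(2)] prv_trans[OF K]])
  moreover have "prv H ((A \<^bold>\<supset> (B \<^bold>\<supset> C)) \<^bold>\<supset> z)"
    unfolding z_def by (rule prv_refl)
  ultimately have z: "prv H (A \<^bold>\<supset> (B \<^bold>\<supset> C))"
    using prv_three_cases[OF Az, of "B \<^bold>\<supset> C" C] unfolding z_def by blast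
  have or: "prv H X" if "prv H (A \<^bold>\<supset> X)" "prv H (B \<^bold>\<supset> X)" for X
    using that assms(1) by (meson luk_axiom.intros(10) prv.ax prv.mp)
  have "prv H (A \<^bold>\<supset> C)"
    by (rule or[OF A prv_exchange[OF z]])
  moreover have "prv H (B \<^bold>\<supset> C)"
    by (rule or[OF z B])
  ultimately show ?thesis
    by (rule or)
qed

lemma prv_conjI: "prv H A \<Longrightarrow> prv H B \<Longrightarrow> prv H (A \<^bold>\<and> B)"
  by (meson luk_axiom.intros(7) prv.ax prv.mp prv_K prv_refl)

lemma prv_or_elim_double:
  assumes "prv H (G \<^bold>\<supset> (G \<^bold>\<supset> (A \<^bold>\<or> B)))"
    and "prv H ((G \<^bold>\<and> A) \<^bold>\<supset> ((G \<^bold>\<and> A) \<^bold>\<supset> C))"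
    and "prv H ((G \<^bold>\<and> B) \<^bold>\<supset> ((G \<^bold>\<and> B) \<^bold>\<supset> C))"
  shows "prv H (G \<^bold>\<supset> (G \<^bold>\<supset> C))"
proof (rule prv_deduction, rule prv_or_elim)
  have imp: "prv (insert G H) (D \<^bold>\<supset> (D \<^bold>\<supset> C))"
    if "prv H ((G \<^bold>\<and> D) \<^bold>\<supset> ((G \<^bold>\<and> D) \<^bold>\<supset> C))" for D
  proof (rule prv_deduction)
    let ?H = "insert D (insert G H)"
    have "prv ?H (G \<^bold>\<and> D)" by (simp add: prv.hyp prv_conjI)
    moreover have "prv ?H ((G \<^bold>\<and> D) \<^bold>\<supset> ((G \<^bold>\<and> D) \<^bold>\<supset> C))"
      using that by (rule prv_mono) auto
    ultimately show "prv ?H C" by (meson prv.mp)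
  qed
  show "prv (insert G H) (A \<^bold>\<supset> (A \<^bold>\<supset> C))" "prv (insert G H) (B \<^bold>\<supset> (B \<^bold>\<supset> C))"
    using imp assms by blast+
  have "prv (insert G H) (G \<^bold>\<supset> (G \<^bold>\<supset> (A \<^bold>\<or> B)))"
    using assms(1) by (rule prv_mono) auto
  then show "prv (insert G H) (A \<^bold>\<or> B)"
    by (meson prv.mp prv.hyp insertI1)
qed

lemma prv_context_weaken:
  assumes "prv H (G \<^bold>\<supset> G')" and "prv H (G' \<^bold>\<supset> (G' \<^bold>\<supset> C))"
  shows "prv H (G \<^bold>\<supset> (G \<^bold>\<supset> C))"
  by (rule prv_trans[OF prv_trans[OF assms] prv_antimono[OF assms(1)]])

subsection \<open>Counting proof lines\<close>

text \<open>Lines form a set, so that earlier lines can be cited without positions; an actual list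
  is extracted only at the end.\<close>

inductive hsteps :: "fm set \<Rightarrow> nat \<Rightarrow> fm set \<Rightarrow> bool" for X where
  base: "hsteps X 0 X"
| ax: "hsteps X n Y \<Longrightarrow> luk_axiom A \<Longrightarrow> hsteps X (Suc n) (insert A Y)"
| mp: "hsteps X n Y \<Longrightarrow> A \<in> Y \<Longrightarrow> (A \<^bold>\<supset> B) \<in> Y \<Longrightarrow> hsteps X (Suc n) (insert B Y)"
| idle: "hsteps X n Y \<Longrightarrow> hsteps X (Suc n) Y"

lemma hsteps_mono: "hsteps X n Y \<Longrightarrow> n \<le> m \<Longrightarrow> hsteps X m Y"
  by (induction m) (auto simp: le_Suc_eq intro: hsteps.idle)

lemma hsteps_superset: "hsteps X n Y \<Longrightarrow> X \<subseteq> Y"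
  by (induction rule: hsteps.induct) auto

lemma hsteps_Un: "hsteps X n Y \<Longrightarrow> hsteps (X \<union> Z) n (Y \<union> Z)"
proof (induction rule: hsteps.induct)
  case (ax n Y A)
  then show ?case using hsteps.ax[of "X \<union> Z" n "Y \<union> Z" A] by simp
next
  case (mp n Y A B)
  then show ?case using hsteps.mp[of "X \<union> Z" n "Y \<union> Z" A B] by simp
qed (auto intro: hsteps.intros)

lemma hsteps_trans: "hsteps Y m Z \<Longrightarrow> hsteps X n Y \<Longrightarrow> hsteps X (n + m) Z"
  by (induction rule: hsteps.induct) (auto intro: hsteps.intros)

definition derives :: "fm set \<Rightarrow> nat \<Rightarrow> fm set \<Rightarrow> bool" where
  "derives X n T \<longleftrightarrow> (\<exists>Y. hsteps X n Y \<and> T \<subseteq> Y)"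

lemma derives_mono:
  assumes "derives X n T" "X \<subseteq> X'" "n \<le> n'" "T' \<subseteq> T"
  shows "derives X' n' T'"
proof -
  obtain Y where Y: "hsteps X n Y" "T \<subseteq> Y" using assms(1) by (auto simp: derives_def)
  then have "hsteps (X \<union> X') n (Y \<union> X')" by (blast intro: hsteps_Un)
  then have "hsteps X' n' (Y \<union> X')" using assms by (simp add: Un_absorb1 hsteps_mono)
  then show ?thesis using Y assms by (auto simp: derives_def)
qed

lemma derives_trans:
  assumes "derives X n T" "derives (X \<union> T) m U"
  shows "derives X (n + m) (X \<union> T \<union> U)"
proof -
  obtain Y where Y: "hsteps X n Y" "T \<subseteq> Y" using assms(1) by (auto simp: derives_def)
  then have "X \<union> T \<subseteq> Y" using hsteps_superset by blast
  then have "derives Y m U" using assms(2) derives_mono by blast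
  then obtain Z where Z: "hsteps Y m Z" "U \<subseteq> Z" by (auto simp: derives_def)
  then have "hsteps X (n + m) Z" "Y \<subseteq> Z"
    using Y hsteps_trans hsteps_superset by blast+
  then show ?thesis
    using Z \<open>X \<union> T \<subseteq> Y\<close> unfolding derives_def by (intro exI[of _ Z]) auto
qed

lemma derives_refl: "T \<subseteq> X \<Longrightarrow> derives X n T"
  by (meson derives_def hsteps.base hsteps_mono le0)

lemma derives_axiom: "luk_axiom A \<Longrightarrow> derives X (Suc 0) {A}"
  by (auto simp: derives_def intro!: exI hsteps.ax hsteps.base)

lemma derives_Union:
  assumes "finite I" "\<And>i. i \<in> I \<Longrightarrow> derives X n (T i)"
  shows "derives X (card I * n) (\<Union>i\<in>I. T i)"
  using assms
proof (induction I rule: finite_induct)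
  case (insert i I)
  have "derives X (card I * n + n) (X \<union> (\<Union>i\<in>I. T i) \<union> T i)"
    using insert by (intro derives_trans) (auto intro: derives_mono)
  then show ?case using insert.hyps by (auto simp: ac_simps elim!: derives_mono)
qed (simp add: derives_refl)

definition hluk_lines :: "fm list \<Rightarrow> bool" where
  "hluk_lines Q \<longleftrightarrow>
     (\<forall>i<length Q. luk_axiom (Q ! i) \<or> (\<exists>j<i. \<exists>k<i. Q ! k = (Q ! j \<^bold>\<supset> Q ! i)))"

lemma hluk_lines_snoc:
  assumes "hluk_lines Q" and "luk_axiom A \<or> (\<exists>B\<in>set Q. (B \<^bold>\<supset> A) \<in> set Q)"
  shows "hluk_lines (Q @ [A])"
  unfolding hluk_lines_def
proof (intro allI impI)
  let ?Q = "Q @ [A]"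
  fix i assume "i < length ?Q"
  then consider "i < length Q" | "i = length Q" by fastforce
  then show "luk_axiom (?Q ! i) \<or> (\<exists>j<i. \<exists>k<i. ?Q ! k = (?Q ! j \<^bold>\<supset> ?Q ! i))"
  proof cases
    case 1
    then have "?Q ! j = Q ! j" if "j \<le> i" for j using that by (simp add: nth_append)
    then show ?thesis
      using assms(1) 1 unfolding hluk_lines_def by (metis less_imp_le order_refl)
  next
    case 2
    then show ?thesis
      using assms(2) by (metis in_set_conv_nth nth_append nth_append_length)
  qed
qed

lemma hluk_lines_take:
  assumes "hluk_lines Q" shows "hluk_lines (take p Q)"
  unfolding hluk_lines_def
proof (intro allI impI)
  fix i assume "i < length (take p Q)"
  then have "i < length Q" "\<And>j. j \<le> i \<Longrightarrow> take p Q ! j = Q ! j" by auto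
  then show "luk_axiom (take p Q ! i) \<or> (\<exists>j<i. \<exists>k<i. take p Q ! k = (take p Q ! j \<^bold>\<supset> take p Q ! i))"
    using assms unfolding hluk_lines_def by (metis less_imp_le order_refl)
qed

lemma hsteps_imp_hluk_lines:
  assumes "hsteps {} n Y"
  shows "\<exists>Q. length Q \<le> n \<and> set Q = Y \<and> hluk_lines Q"
  using assms
proof (induction rule: hsteps.induct)
  case base
  show ?case by (rule exI[of _ "[]"]) (simp add: hluk_lines_def)
next
  case (ax n Y A)
  then obtain Q where "length Q \<le> n" "set Q = Y" "hluk_lines Q" by blast
  with ax.hyps show ?case
    by (intro exI[of _ "Q @ [A]"]) (auto intro: hluk_lines_snoc)
next
  case (mp n Y A B)
  then obtain Q where "length Q \<le> n" "set Q = Y" "hluk_lines Q" by blast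
  with mp.hyps show ?case
    by (intro exI[of _ "Q @ [B]"]) (auto intro: hluk_lines_snoc)
next
  case (idle n Y)
  then show ?case using le_SucI by blast
qed

lemma derives_imp_hluk_proof:
  assumes "derives {} n T" "A \<in> T"
  shows "\<exists>Q. hluk_proof Q A \<and> length Q \<le> n"
proof -
  obtain Y where "hsteps {} n Y" "A \<in> Y"
    using assms by (auto simp: derives_def)
  then obtain Q where Q: "length Q \<le> n" "A \<in> set Q" "hluk_lines Q"
    using hsteps_imp_hluk_lines by metis
  then obtain p where p: "p < length Q" "Q ! p = A" by (metis in_set_conv_nth)
  \<comment> \<open>A proof has to end with \<open>A\<close>, so the list is cut off right after an
    occurrence of \<open>A\<close>.\<close>
  then have "hluk_proof (take (Suc p) Q) A"
    using hluk_lines_take[OF Q(3), of "Suc p"]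
    unfolding hluk_proof_def hluk_lines_def by (auto simp: take_Suc_conv_app_nth)
  moreover have "length (take (Suc p) Q) \<le> n" using Q by simp
  ultimately show ?thesis by blast
qed

section \<open>Rules with a uniform bound on their cost\<close>

primrec subst :: "(nat \<Rightarrow> fm) \<Rightarrow> fm \<Rightarrow> fm" where
  "subst \<sigma> (Var x) = \<sigma> x"
| "subst \<sigma> (Neg A) = Neg (subst \<sigma> A)"
| "subst \<sigma> (A \<^bold>\<and> B) = (subst \<sigma> A \<^bold>\<and> subst \<sigma> B)"
| "subst \<sigma> (A \<^bold>\<or> B) = (subst \<sigma> A \<^bold>\<or> subst \<sigma> B)"
| "subst \<sigma> (A \<^bold>\<supset> B) = (subst \<sigma> A \<^bold>\<supset> subst \<sigma> B)"

lemma luk_axiom_subst: "luk_axiom A \<Longrightarrow> luk_axiom (subst \<sigma> A)"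
  by (induction rule: luk_axiom.induct) (auto intro: luk_axiom.intros)

text \<open>A derivation of one instance in variables bounds the derivations of all instances.\<close>

lemma prv_imp_derives:
  assumes "prv H A"
  shows "\<exists>n. \<forall>\<sigma> X. subst \<sigma> ` H \<subseteq> X \<longrightarrow> derives X n {subst \<sigma> A}"
  using assms
proof (induction rule: prv.induct)
  case (hyp A)
  then show ?case by (auto intro!: derives_refl)
next
  case (ax A)
  then show ?case using derives_axiom luk_axiom_subst by blast
next
  case (mp A B)
  then obtain n m where nm: "\<And>\<sigma> X. subst \<sigma> ` H \<subseteq> X \<Longrightarrow> derives X n {subst \<sigma> A}"
    "\<And>\<sigma> X. subst \<sigma> ` H \<subseteq> X \<Longrightarrow> derives X m {subst \<sigma> (A \<^bold>\<supset> B)}" by blast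
  have "derives X (n + m + Suc 0) {subst \<sigma> B}" if "subst \<sigma> ` H \<subseteq> X" for \<sigma> X
  proof -
    have "derives X (n + m) (X \<union> {subst \<sigma> A} \<union> {subst \<sigma> (A \<^bold>\<supset> B)})"
      using that by (intro derives_trans nm) auto
    then obtain Y where "hsteps X (n + m) Y" "subst \<sigma> A \<in> Y" "subst \<sigma> (A \<^bold>\<supset> B) \<in> Y"
      by (auto simp: derives_def)
    then have "hsteps X (Suc (n + m)) (insert (subst \<sigma> B) Y)"
      by (auto intro: hsteps.mp)
    then show ?thesis by (auto simp: derives_def)
  qed
  then show ?case by blast
qed

lemma prv_imp_derives_uniform:
  assumes "\<forall>(H, A)\<in>set rules. prv H A"
  shows "\<exists>n. \<forall>(H, A)\<in>set rules. \<forall>\<sigma> X. subst \<sigma> ` H \<subseteq> X \<longrightarrow> derives X n {subst \<sigma> A}"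
  using assms
proof (induction rules)
  case (Cons r rules)
  obtain H A where r: "r = (H, A)" by force
  obtain n m where nm: "\<forall>\<sigma> X. subst \<sigma> ` H \<subseteq> X \<longrightarrow> derives X n {subst \<sigma> A}"
    "\<forall>(H, A)\<in>set rules. \<forall>\<sigma> X. subst \<sigma> ` H \<subseteq> X \<longrightarrow> derives X m {subst \<sigma> A}"
    using Cons prv_imp_derives[of H A] by (auto simp: r)
  have "derives X (n + m) {subst \<sigma> B}" if "(H', B) \<in> set (r # rules)" "subst \<sigma> ` H' \<subseteq> X" for \<sigma> X H' B
  proof (cases "(H', B) = r")
    case True
    then have "derives X n {subst \<sigma> B}" using nm(1) that by (auto simp: r)
    then show ?thesis by (rule derives_mono) auto
  next
    case False
    then have "derives X m {subst \<sigma> B}" using nm(2) that by auto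
    then show ?thesis by (rule derives_mono) auto
  qed
  then show ?case by blast
qed simp

text \<open>
  The deduction theorem fails for \<open>\<supset>\<close>, but by contraction it holds for \<open>G \<supset> (G \<supset> A)\<close>.
\<close>

abbreviation double_imp :: "fm \<Rightarrow> fm \<Rightarrow> fm" (infixr "\<leadsto>" 25) where
  "G \<leadsto> A \<equiv> G \<^bold>\<supset> (G \<^bold>\<supset> A)"

text \<open>One bound \<open>K\<close>, the same for all formulas, for every rule that the
  simulation uses. From here on the axioms of the logic enter only as single lines.\<close>

locale derived_rules =
  fixes K :: nat
  assumes refl_rule: "derives X K {G \<^bold>\<supset> G}"
    and trans_rule: "{G \<^bold>\<supset> G', G' \<^bold>\<supset> C} \<subseteq> X \<Longrightarrow> derives X K {G \<^bold>\<supset> C}"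
    and const_rule: "{A} \<subseteq> X \<Longrightarrow> derives X K {G \<leadsto> A}"
    and assume_rule: "derives X K {(G \<^bold>\<and> A) \<leadsto> A}"
    and weaken_rule: "{G \<^bold>\<supset> G', G' \<leadsto> A} \<subseteq> X \<Longrightarrow> derives X K {G \<leadsto> A}"
    and mp_rule: "{G \<leadsto> A, G \<leadsto> (A \<^bold>\<supset> B)} \<subseteq> X \<Longrightarrow> derives X K {G \<leadsto> B}"
    and or_rule: "{G \<leadsto> (A \<^bold>\<or> B), (G \<^bold>\<and> A) \<leadsto> C, (G \<^bold>\<and> B) \<leadsto> C} \<subseteq> X \<Longrightarrow> derives X K {G \<leadsto> C}"
    and discharge_rule: "{G, G \<leadsto> A} \<subseteq> X \<Longrightarrow> derives X K {A}"

lemma derived_rules_exists: "\<exists>K. derived_rules K"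
proof -
  define g g' a b c where vars: "g = Var 0" "g' = Var 1" "a = Var 2" "b = Var 3" "c = Var 4"
  define rules where "rules =
    [({}, g \<^bold>\<supset> g),
     ({g \<^bold>\<supset> g', g' \<^bold>\<supset> c}, g \<^bold>\<supset> c),
     ({a}, g \<leadsto> a),
     ({}, (g \<^bold>\<and> a) \<leadsto> a),
     ({g \<^bold>\<supset> g', g' \<leadsto> a}, g \<leadsto> a),
     ({g \<leadsto> a, g \<leadsto> (a \<^bold>\<supset> b)}, g \<leadsto> b),
     ({g \<leadsto> (a \<^bold>\<or> b), (g \<^bold>\<and> a) \<leadsto> c, (g \<^bold>\<and> b) \<leadsto> c}, g \<leadsto> c),
     ({g, g \<leadsto> a}, a)]"
  have "\<forall>(H, A)\<in>set rules. prv H A"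
  proof -
    have 1: "prv {} (g \<^bold>\<supset> g)" by (rule prv_refl)
    have 2: "prv {g \<^bold>\<supset> g', g' \<^bold>\<supset> c} (g \<^bold>\<supset> c)" by (rule prv_trans[of _ _ g']; rule prv.hyp) auto
    have 3: "prv {a} (g \<leadsto> a)" by (intro prv_K prv.hyp) simp
    have 4: "prv {} ((g \<^bold>\<and> a) \<leadsto> a)" by (intro prv_K prv.ax luk_axiom.intros)
    have 5: "prv {g \<^bold>\<supset> g', g' \<leadsto> a} (g \<leadsto> a)"
      by (rule prv_context_weaken[of _ _ g']; rule prv.hyp) auto
    have 6: "prv {g \<leadsto> a, g \<leadsto> (a \<^bold>\<supset> b)} (g \<leadsto> b)"
      by (rule prv_mp_double[of _ _ a]; rule prv.hyp) auto
    have 7: "prv {g \<leadsto> (a \<^bold>\<or> b), (g \<^bold>\<and> a) \<leadsto> c, (g \<^bold>\<and> b) \<leadsto> c} (g \<leadsto> c)"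
      by (rule prv_or_elim_double[of _ _ a b]; rule prv.hyp) auto
    have 8: "prv {g, g \<leadsto> a} a"
      by (meson insertI1 insertI2 prv.hyp prv.mp)
    show ?thesis using 1 2 3 4 5 6 7 8 by (simp add: rules_def)
  qed
  then obtain K where K: "\<forall>(H, A)\<in>set rules. \<forall>\<sigma> X. subst \<sigma> ` H \<subseteq> X \<longrightarrow> derives X K {subst \<sigma> A}"
    using prv_imp_derives_uniform by blast
  \<comment> \<open>The variables are numbered 0 to 4, so indexing into a list of five formulas is
    the substitution.\<close>
  have inst: "subst (nth [G, G', A, B, C]) ` H \<subseteq> X \<Longrightarrow> derives X K {subst (nth [G, G', A, B, C]) F}"
    if "(H, F) \<in> set rules" for G G' A B C H F X
    using bspec[OF K that] by simp
  have "derived_rules K"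
  proof
    fix X G G' A B C
    note inst = inst[of _ _ G G' A B C X, unfolded rules_def]
    show "derives X K {G \<^bold>\<supset> G}"
      using inst[of "{}" "g \<^bold>\<supset> g"] by (simp add: vars)
    show "derives X K {G \<^bold>\<supset> C}" if "{G \<^bold>\<supset> G', G' \<^bold>\<supset> C} \<subseteq> X"
      using inst[of "{g \<^bold>\<supset> g', g' \<^bold>\<supset> c}" "g \<^bold>\<supset> c"] that by (simp add: vars)
    show "derives X K {G \<leadsto> A}" if "{A} \<subseteq> X"
      using inst[of "{a}" "g \<leadsto> a"] that by (simp add: vars)
    show "derives X K {(G \<^bold>\<and> A) \<leadsto> A}"
      using inst[of "{}" "(g \<^bold>\<and> a) \<leadsto> a"] by (simp add: vars)
    show "derives X K {G \<leadsto> A}" if "{G \<^bold>\<supset> G', G' \<leadsto> A} \<subseteq> X"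
      using inst[of "{g \<^bold>\<supset> g', g' \<leadsto> a}" "g \<leadsto> a"] that by (simp add: vars)
    show "derives X K {G \<leadsto> B}" if "{G \<leadsto> A, G \<leadsto> (A \<^bold>\<supset> B)} \<subseteq> X"
      using inst[of "{g \<leadsto> a, g \<leadsto> (a \<^bold>\<supset> b)}" "g \<leadsto> b"] that by (simp add: vars)
    show "derives X K {G \<leadsto> C}" if "{G \<leadsto> (A \<^bold>\<or> B), (G \<^bold>\<and> A) \<leadsto> C, (G \<^bold>\<and> B) \<leadsto> C} \<subseteq> X"
      using inst[of "{g \<leadsto> (a \<^bold>\<or> b), (g \<^bold>\<and> a) \<leadsto> c, (g \<^bold>\<and> b) \<leadsto> c}" "g \<leadsto> c"] that by (simp add: vars)
    show "derives X K {A}" if "{G, G \<leadsto> A} \<subseteq> X"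
      using inst[of "{g, g \<leadsto> a}" a] that by (simp add: vars)
  qed
  then show ?thesis by blast
qed

subsection \<open>The simulation\<close>

text \<open>The fold starts with an axiom, so the empty context can be discharged, and nests to the
  left, so that opening an assumption adds one outer conjunct and schema (5) removes it.\<close>

definition ctx_fm :: "fm list \<Rightarrow> fm" where
  "ctx_fm = foldl Conj (Var 0 \<^bold>\<supset> (Var 0 \<^bold>\<supset> Var 0))"

lemma ctx_fm_snoc: "ctx_fm (u @ [A]) = (ctx_fm u \<^bold>\<and> A)"
  by (simp add: ctx_fm_def)

lemma luk_axiom_ctx_fm_Nil: "luk_axiom (ctx_fm [])"
  by (simp add: ctx_fm_def luk_axiom.intros)

abbreviation imps :: "fm list rel \<Rightarrow> fm set" where
  "imps E \<equiv> (\<lambda>(u, w). ctx_fm u \<^bold>\<supset> ctx_fm w) ` E"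

definition line_fm :: "line \<Rightarrow> fm" where
  "line_fm l = (ctx_fm (ctx l) \<leadsto> form l)"

text \<open>The tree of contexts with root \<open>[]\<close>. Openings that lead to equal lists
  share a node, since the context formula depends only on the list.\<close>

definition contexts :: "line list \<Rightarrow> fm list set" where
  "contexts P = insert [] (ctx ` {l \<in> set P. opens l})"

lemma finite_contexts: "finite (contexts P)"
  by (simp add: contexts_def)

lemma card_contexts: "card (contexts P) \<le> Suc (num_openings P)"
proof -
  have "card (contexts P) \<le> Suc (card (ctx ` set (filter opens P)))"
    unfolding contexts_def by (simp add: card_insert_if)
  also have "card (ctx ` set (filter opens P)) \<le> num_openings P"
    unfolding num_openings_def by (meson List.finite_set card_image_le card_length le_trans)
  finally show ?thesis by simp
qed

lemma num_openings_le: "num_openings P \<le> length P"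
  by (simp add: num_openings_def)

text \<open>The induction is over all prefixes at once because \<open>OrE\<close> and
  \<open>OpenAlt\<close> return to a shortened context.\<close>

lemma prefix_ctx_in_contexts:
  assumes "\<forall>i<length P. line_ok P i" "i < length P" "prefix w (ctx (P ! i))"
  shows "w \<in> contexts P"
  using assms(2,3)
proof (induction i arbitrary: w rule: less_induct)
  case (less i)
  have ok: "line_ok P i" using assms(1) less.prems by blast
  have current: "v \<in> contexts P" if "prefix v (current_ctx P i)" for v
  proof (cases "i = 0")
    case False
    then show ?thesis using less.IH[of "i - 1" v] less.prems(1) that by (simp add: current_ctx_def)
  qed (use that in \<open>simp add: current_ctx_def contexts_def\<close>)
  have self: "ctx (P ! i) \<in> contexts P" if "opens (P ! i)"
    using that less.prems by (auto simp: contexts_def)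
  show ?case
  proof (cases "just (P ! i)")
    case Axiom
    then show ?thesis using ok current less.prems by (simp add: line_ok_def)
  next
    case Open
    then have "prefix w (current_ctx P i) \<or> w = ctx (P ! i)"
      using ok less.prems by (auto simp: line_ok_def)
    then show ?thesis using current self Open by (auto simp: opens_def)
  next
    case (OpenAlt a)
    then obtain \<Gamma> where G: "ctx (P ! a) = \<Gamma> @ [form (P ! a)]" "ctx (P ! i) = \<Gamma> @ [form (P ! i)]" "a < i"
      using ok by (auto simp: line_ok_def block_def)
    then have "prefix w (ctx (P ! a)) \<or> w = ctx (P ! i)"
      using less.prems by auto
    then show ?thesis using less.IH[of a w] G(3) less.prems self OpenAlt by (auto simp: opens_def)
  next
    case (MP j k)
    then show ?thesis using ok current less.prems by (simp add: line_ok_def)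
  next
    case (OrE d a b)
    then have "a < i" "ctx (P ! a) = ctx (P ! i) @ [form (P ! a)]"
      using ok by (auto simp: line_ok_def block_def)
    then show ?thesis using less.IH[of a w] less.prems by auto
  qed
qed

lemma ctx_in_contexts: "\<forall>i<length P. line_ok P i \<Longrightarrow> i < length P \<Longrightarrow> ctx (P ! i) \<in> contexts P"
  using prefix_ctx_in_contexts by blast

lemma contexts_prefix_closed:
  assumes "\<forall>i<length P. line_ok P i" "u \<in> contexts P" "prefix w u"
  shows "w \<in> contexts P"
proof (cases "u = []")
  case False
  then obtain i where "i < length P" "u = ctx (P ! i)"
    using assms(2) by (auto simp: contexts_def in_set_conv_nth)
  then show ?thesis using assms prefix_ctx_in_contexts by blast
qed (use assms in auto)

lemma covers_prefix_closed:
  assumes "\<And>u w. u \<in> T \<Longrightarrow> prefix w u \<Longrightarrow> w \<in> T" and "(u, w) \<in> covers T"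
  shows "\<exists>a. u = w @ [a]"
proof -
  obtain a v where u: "u = w @ a # v"
    using assms(2) by (auto simp: covers_def elim: strict_prefixE')
  have "w @ [a] \<in> T" using assms u by (auto simp: covers_def)
  moreover have "strict_prefix w (w @ [a])" by (simp add: strict_prefix_def)
  ultimately have "\<not> strict_prefix (w @ [a]) u" using assms(2) by (auto simp: covers_def)
  then show ?thesis using u by (auto simp: strict_prefix_def)
qed

lemma derives_imps_covers:
  assumes "finite T" "\<And>u w. u \<in> T \<Longrightarrow> prefix w u \<Longrightarrow> w \<in> T"
  shows "derives {} (card T) (imps (covers T))"
proof -
  have sub: "covers T \<subseteq> (\<lambda>u. (u, butlast u)) ` T"
  proof safe
    fix u w assume uw: "(u, w) \<in> covers T"
    then obtain a where "u = w @ [a]" using covers_prefix_closed assms(2) by blast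
    then show "(u, w) \<in> (\<lambda>u. (u, butlast u)) ` T" using uw by (force simp: covers_def)
  qed
  then have fin: "finite (covers T)" using assms(1) by (simp add: finite_subset)
  have card: "card (covers T) \<le> card T"
    using assms(1) sub by (meson card_image_le card_mono finite_imageI le_trans)
  have "derives {} 1 {ctx_fm u \<^bold>\<supset> ctx_fm w}" if uw: "(u, w) \<in> covers T" for u w
  proof -
    obtain a where "u = w @ [a]" using uw covers_prefix_closed assms(2) by blast
    then show ?thesis by (simp add: ctx_fm_snoc derives_axiom luk_axiom.intros)
  qed
  then have "derives {} (card (covers T) * 1) (\<Union>e\<in>covers T. {case e of (u, w) \<Rightarrow> ctx_fm u \<^bold>\<supset> ctx_fm w})"
    using fin by (intro derives_Union) auto
  then show ?thesis using card by (auto elim!: derives_mono)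
qed

section \<open>The cost of simulating lines\<close>

context derived_rules
begin

lemma derives_trcl_steps:
  assumes "trcl_steps B n E"
  shows "derives (imps B) (n * K) (imps B \<union> imps E)"
  using assms
proof (induction rule: trcl_steps.induct)
  case base
  then show ?case by (simp add: derives_refl)
next
  case (step n E u v w)
  have "derives (imps B \<union> (imps B \<union> imps E)) K {ctx_fm u \<^bold>\<supset> ctx_fm w}"
    using step.hyps by (intro trans_rule[of _ "ctx_fm v"]) force
  then have "derives (imps B) (n * K + K) (imps B \<union> (imps B \<union> imps E) \<union> {ctx_fm u \<^bold>\<supset> ctx_fm w})"
    by (rule derives_trans[OF step.IH])
  then show ?case by (rule derives_mono) auto
next
  case (idle n E)
  show ?case by (rule derives_mono[OF idle.IH]) auto
qed

text \<open>The \<open>+ 1\<close> pays for reflexivity, the case of no hops.\<close>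

lemma derives_relpow:
  assumes "imps E \<subseteq> X" "(u, w) \<in> (E \<union> Id) ^^ h"
  shows "derives X (K * (h + 1)) {ctx_fm u \<^bold>\<supset> ctx_fm w}"
  using assms(2)
proof (induction h arbitrary: w)
  case 0
  then show ?case using refl_rule by simp
next
  case (Suc h)
  then obtain v where v: "(u, v) \<in> (E \<union> Id) ^^ h" "(v, w) \<in> E \<union> Id" by auto
  have IH: "derives X (K * (h + 1)) {ctx_fm u \<^bold>\<supset> ctx_fm v}" by (rule Suc.IH[OF v(1)])
  show ?case
  proof (cases "v = w")
    case True
    then show ?thesis using IH by (auto elim!: derives_mono)
  next
    case False
    then have "(ctx_fm v \<^bold>\<supset> ctx_fm w) \<in> X" using v(2) assms(1) by force
    then have "derives (X \<union> {ctx_fm u \<^bold>\<supset> ctx_fm v}) K {ctx_fm u \<^bold>\<supset> ctx_fm w}"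
      by (intro trans_rule[of _ "ctx_fm v"]) auto
    then have "derives X (K * (h + 1) + K) (X \<union> {ctx_fm u \<^bold>\<supset> ctx_fm v} \<union> {ctx_fm u \<^bold>\<supset> ctx_fm w})"
      by (rule derives_trans[OF IH])
    then show ?thesis by (auto elim!: derives_mono)
  qed
qed

lemma derives_weaken_context:
  assumes "imps E \<subseteq> X" "(ctx_fm w \<leadsto> A) \<in> X" "(u, w) \<in> (E \<union> Id) ^^ h"
  shows "derives X (K * (h + 2)) {ctx_fm u \<leadsto> A}"
proof -
  have "derives X (K * (h + 1)) {ctx_fm u \<^bold>\<supset> ctx_fm w}"
    using assms by (blast intro: derives_relpow)
  moreover have "derives (X \<union> {ctx_fm u \<^bold>\<supset> ctx_fm w}) K {ctx_fm u \<leadsto> A}"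
    using assms(2) by (intro weaken_rule[of _ "ctx_fm w"]) auto
  ultimately have "derives X (K * (h + 1) + K) (X \<union> {ctx_fm u \<^bold>\<supset> ctx_fm w} \<union> {ctx_fm u \<leadsto> A})"
    by (rule derives_trans)
  then show ?thesis by (auto elim!: derives_mono)
qed

text \<open>Modus ponens is the most expensive case: two imports at \<open>K * (h + 2)\<close> each
  and one rule. Disjunction elimination imports only the disjunction, as the last lines of its
  blocks already have the contexts that the rule expects. The final \<open>1\<close> covers writing
  down an axiom.\<close>

lemma derives_line:
  assumes ok: "\<forall>i<length P. line_ok P i" and i: "i < length P"
    and hop: "hop_bound (contexts P) h E"
    and X: "imps E \<subseteq> X" "\<And>j. j < i \<Longrightarrow> line_fm (P ! j) \<in> X"
  shows "derives X (3 * K * (h + 2) + 1) {line_fm (P ! i)}"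
proof -
  let ?G = "ctx_fm (ctx (P ! i))"
  have avail: "derives Y (K * (h + 2)) {?G \<leadsto> form (P ! j)}" if "available P i j" "X \<subseteq> Y" for j Y
  proof -
    have j: "j < i" "prefix (ctx (P ! j)) (ctx (P ! i))" using that(1) by (auto simp: available_def)
    then have "(ctx (P ! i), ctx (P ! j)) \<in> (E \<union> Id) ^^ h"
      using hop i ctx_in_contexts[OF ok] by (simp add: hop_bound_def)
    then show ?thesis
      using X j(1) that(2) by (intro derives_weaken_context) (auto simp: line_fm_def)
  qed
  have oki: "line_ok P i" using ok i by blast
  show ?thesis
  proof (cases "just (P ! i)")
    case Axiom
    then have "derives X (Suc 0) {form (P ! i)}"
      using oki by (simp add: line_ok_def derives_axiom)
    then have "derives X (Suc 0 + K) (X \<union> {form (P ! i)} \<union> {line_fm (P ! i)})"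
      unfolding line_fm_def by (rule derives_trans) (rule const_rule, simp)
    then show ?thesis by (rule derives_mono) auto
  next
    case Open
    then have "?G = (ctx_fm (current_ctx P i) \<^bold>\<and> form (P ! i))"
      using oki by (simp add: line_ok_def ctx_fm_snoc)
    then have "derives X K {line_fm (P ! i)}"
      using assume_rule by (simp add: line_fm_def)
    then show ?thesis by (rule derives_mono) auto
  next
    case (OpenAlt a)
    then obtain \<Gamma> where "ctx (P ! i) = \<Gamma> @ [form (P ! i)]"
      using oki by (auto simp: line_ok_def)
    then have "?G = (ctx_fm \<Gamma> \<^bold>\<and> form (P ! i))"
      by (metis ctx_fm_snoc)
    then have "derives X K {line_fm (P ! i)}"
      using assume_rule by (simp add: line_fm_def)
    then show ?thesis by (rule derives_mono) auto
  next
    case (MP j k)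
    then have jk: "available P i j" "available P i k" "form (P ! k) = (form (P ! j) \<^bold>\<supset> form (P ! i))"
      using oki by (auto simp: line_ok_def)
    let ?Y = "X \<union> {?G \<leadsto> form (P ! j)} \<union> {?G \<leadsto> form (P ! k)}"
    have "derives X (K * (h + 2) + K * (h + 2)) ?Y"
      by (rule derives_trans[OF avail[OF jk(1) order_refl] avail[OF jk(2)]]) auto
    moreover have "derives (X \<union> ?Y) K {line_fm (P ! i)}"
      unfolding line_fm_def by (rule mp_rule[of _ "form (P ! j)"]) (use jk in auto)
    ultimately have "derives X (K * (h + 2) + K * (h + 2) + K) (X \<union> ?Y \<union> {line_fm (P ! i)})"
      by (rule derives_trans)
    then show ?thesis by (rule derives_mono) (auto simp: algebra_simps)
  next
    case (OrE d a b)
    have d: "available P i d"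
      and form: "form (P ! d) = (form (P ! a) \<^bold>\<or> form (P ! b)) \<or> form (P ! d) = (form (P ! b) \<^bold>\<or> form (P ! a))"
      and blocks: "block P a b" "block P b i"
      and ctx: "ctx (P ! a) = ctx (P ! i) @ [form (P ! a)]" "ctx (P ! b) = ctx (P ! i) @ [form (P ! b)]"
      and concl: "form (P ! (b - 1)) = form (P ! i)" "form (P ! (i - 1)) = form (P ! i)"
      using OrE oki by (auto simp: line_ok_def)
    have lines: "line_fm (P ! (b - 1)) = ((?G \<^bold>\<and> form (P ! a)) \<leadsto> form (P ! i))"
      "line_fm (P ! (i - 1)) = ((?G \<^bold>\<and> form (P ! b)) \<leadsto> form (P ! i))"
      using blocks ctx concl by (auto simp: line_fm_def block_def ctx_fm_snoc)
    moreover have "line_fm (P ! (b - 1)) \<in> X" "line_fm (P ! (i - 1)) \<in> X"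
      using blocks by (auto simp: block_def intro!: X(2))
    ultimately have "{(?G \<^bold>\<and> form (P ! a)) \<leadsto> form (P ! i), (?G \<^bold>\<and> form (P ! b)) \<leadsto> form (P ! i)} \<subseteq> X"
      by simp
    then have "derives (X \<union> {?G \<leadsto> form (P ! d)}) K {line_fm (P ! i)}"
      using form or_rule[of ?G "form (P ! a)" "form (P ! b)" "form (P ! i)"]
        or_rule[of ?G "form (P ! b)" "form (P ! a)" "form (P ! i)"]
      unfolding line_fm_def by fastforce
    then have "derives X (K * (h + 2) + K) (X \<union> {?G \<leadsto> form (P ! d)} \<union> {line_fm (P ! i)})"
      by (rule derives_trans[OF avail[OF d order_refl]])
    then show ?thesis by (rule derives_mono) (auto simp: algebra_simps)
  qed
qed

text \<open>The summands pay for the parent edges, the shortcuts, the lines of \<open>P\<close>, and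
  the discharge of the empty context from the last line.\<close>

lemma simulation:
  assumes P: "nested_disj_proof P A"
    and E: "trcl_steps (covers (contexts P)) e E" "hop_bound (contexts P) h E"
  shows "\<exists>Q. hluk_proof Q A \<and>
    length Q \<le> card (contexts P) + e * K + length P * (3 * K * (h + 2) + 1) + (K + 1)"
proof -
  have ok: "\<forall>i<length P. line_ok P i" and ne: "P \<noteq> []" and last: "form (last P) = A" "ctx (last P) = []"
    using P by (auto simp: nested_disj_proof_def)
  let ?c = "3 * K * (h + 2) + 1"
  let ?B = "imps (covers (contexts P))"
  have "derives {} (card (contexts P)) ?B"
    using finite_contexts contexts_prefix_closed[OF ok] by (rule derives_imps_covers)
  then have "derives {} (card (contexts P) + e * K) ({} \<union> ?B \<union> (?B \<union> imps E))"
    by (rule derives_trans) (use derives_trcl_steps[OF E(1)] in simp)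
  then have start: "derives {} (card (contexts P) + e * K) (imps E)"
    by (rule derives_mono) auto
  have "derives (imps E) (i * ?c) (imps E \<union> (\<lambda>j. line_fm (P ! j)) ` {..<i})" if "i \<le> length P" for i
    using that
  proof (induction i)
    case 0
    then show ?case by (simp add: derives_refl)
  next
    case (Suc i)
    let ?L = "imps E \<union> (\<lambda>j. line_fm (P ! j)) ` {..<i}"
    have "derives (imps E \<union> ?L) ?c {line_fm (P ! i)}"
      using Suc.prems by (intro derives_line[OF ok _ E(2)]) auto
    then have "derives (imps E) (i * ?c + ?c) (imps E \<union> ?L \<union> {line_fm (P ! i)})"
      using Suc by (intro derives_trans) auto
    then show ?case by (rule derives_mono) (auto simp: lessThan_Suc)
  qed
  then have "derives (imps E) (length P * ?c) (imps E \<union> (\<lambda>j. line_fm (P ! j)) ` {..<length P})"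
    by blast
  moreover have "line_fm (last P) \<in> (\<lambda>j. line_fm (P ! j)) ` {..<length P}"
    using ne by (simp add: last_conv_nth)
  ultimately have "derives (imps E) (length P * ?c) {line_fm (last P)}"
    by (elim derives_mono) auto
  then have "derives {} (card (contexts P) + e * K + length P * ?c) ({} \<union> imps E \<union> {line_fm (last P)})"
    using start by (intro derives_trans) (auto elim: derives_mono)
  then have *: "derives {} (card (contexts P) + e * K + length P * ?c) {line_fm (last P)}"
    by (rule derives_mono) auto
  have "derives {line_fm (last P)} (Suc 0 + K) ({line_fm (last P)} \<union> {ctx_fm []} \<union> {A})"
    by (rule derives_trans[OF derives_axiom[OF luk_axiom_ctx_fm_Nil]], rule discharge_rule[of "ctx_fm []"])
      (use last in \<open>auto simp: line_fm_def\<close>)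
  then have "derives {} (card (contexts P) + e * K + length P * ?c + (Suc 0 + K))
      ({} \<union> {line_fm (last P)} \<union> ({line_fm (last P)} \<union> {ctx_fm []} \<union> {A}))"
    by (intro derives_trans[OF *]) simp
  then show ?thesis
    using derives_imp_hluk_proof[of _ _ A] by (fastforce simp: ac_simps)
qed

end

section \<open>Iterated logarithms\<close>

lemma log_iter_reaches_1: "\<exists>k. int k \<le> max 0 (\<lceil>x\<rceil> - 1) \<and> (log_iter i ^^ k) x \<le> 1"
proof -
  \<comment> \<open>If \<open>f\<close> lowers the ceiling of every number above 1 by at least one
    until 1 is reached, then iterating \<open>f\<close> gets to 1 in time. The number of iterations
    obeys the same bound as \<open>f\<close>, so the property passes from \<open>log_iter i\<close>
    to \<open>log_iter (Suc i)\<close>.\<close>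
  have reach: "\<exists>k. int k \<le> max 0 (\<lceil>x\<rceil> - 1) \<and> (f ^^ k) x \<le> 1"
    if f: "\<And>x. 1 < x \<Longrightarrow> f x \<le> max 1 (of_int \<lceil>x\<rceil> - 1)" for f :: "real \<Rightarrow> real" and x
  proof (induction "nat \<lceil>x\<rceil>" arbitrary: x rule: less_induct)
    case less
    show ?case
    proof (cases "x \<le> 1")
      case True
      then show ?thesis by (intro exI[of _ 0]) simp
    next
      case False
      then have c: "2 \<le> \<lceil>x\<rceil>" by linarith
      have "f x \<le> of_int (max 1 (\<lceil>x\<rceil> - 1))"
        using f[of x] False by (simp add: of_int_max)
      then have le: "\<lceil>f x\<rceil> \<le> \<lceil>x\<rceil> - 1" using c by linarith
      then obtain k where "int k \<le> max 0 (\<lceil>f x\<rceil> - 1)" "(f ^^ k) (f x) \<le> 1"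
        using less[of "f x"] c by (auto simp: nat_less_eq_zless)
      moreover from this have "int (Suc k) \<le> max 0 (\<lceil>x\<rceil> - 1)" using le c by linarith
      ultimately show ?thesis by (intro exI[of _ "Suc k"]) (auto simp: funpow_swap1)
    qed
  qed
  have le: "1 < x \<Longrightarrow> log_iter i x \<le> max 1 (of_int \<lceil>x\<rceil> - 1)" for x
  proof (induction i arbitrary: x)
    case 0
    show ?case
    proof (cases "x \<le> 2")
      case True
      then show ?thesis using 0 by simp
    next
      case False
      \<comment> \<open>The aim is \<open>log 2 x \<le> x - 1\<close>: the tangent bound is applied
        to \<open>x / 2\<close>, and \<open>ln 2\<close> is at least \<open>1 / 2\<close>.\<close>
      have "ln (1 / 2 :: real) \<le> 1 / 2 - 1" by (rule ln_le_minus_one) simp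
      then have ln2: "1 / 2 \<le> ln (2 :: real)" by (simp add: ln_div)
      have "ln (x / 2) \<le> x / 2 - 1" using False by (intro ln_le_minus_one) simp
      also have "\<dots> = (x - 2) * (1 / 2)" by simp
      also have "\<dots> \<le> (x - 2) * ln 2" using False ln2 by (intro mult_left_mono) auto
      finally have "ln x \<le> (x - 1) * ln 2" using False by (simp add: ln_div algebra_simps)
      then have "log 2 x \<le> x - 1" by (simp add: log_def field_simps)
      then show ?thesis by (simp add: le_max_iff_disj) linarith
    qed
  next
    case (Suc i)
    obtain k where k: "int k \<le> max 0 (\<lceil>x\<rceil> - 1)" "(log_iter i ^^ k) x \<le> 1"
      using reach[OF Suc.IH] by blast
    have "(LEAST k. (log_iter i ^^ k) x \<le> 1) \<le> k" using k(2) by (rule Least_le)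
    then show ?case using k(1) Suc.prems by simp
  qed
  show "\<exists>k. int k \<le> max 0 (\<lceil>x\<rceil> - 1) \<and> (log_iter i ^^ k) x \<le> 1" by (rule reach[OF le])
qed

text \<open>The iteration does reach 1, so the \<open>LEAST\<close> is attained, and it is not 0
  because \<open>x\<close> itself exceeds 1.\<close>

lemma log_iter_ge_1: "2 \<le> x \<Longrightarrow> 1 \<le> log_iter i x"
proof (cases i)
  case (Suc j)
  assume "2 \<le> x"
  obtain k where "(log_iter j ^^ k) x \<le> 1" using log_iter_reaches_1 by blast
  then have "(log_iter j ^^ (LEAST k. (log_iter j ^^ k) x \<le> 1)) x \<le> 1" by (rule LeastI)
  then have "(LEAST k. (log_iter j ^^ k) x \<le> 1) \<noteq> 0"
    using \<open>2 \<le> x\<close> by (intro notI) simp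
  then show ?thesis by (simp add: Suc)
qed simp

text \<open>For \<open>m \<le> 1\<close> the product \<open>m * log_iter i m\<close> is 0, while
  every proof has a line; hence the \<open>max 1\<close>.\<close>

theorem theorem10:
  shows "(\<exists>c::real. \<forall>(n::nat) A.
            (\<exists>P. nested_disj_proof P A \<and> length P = n) \<longrightarrow>
            (\<exists>Q. hluk_proof Q A \<and>
                 real (length Q) \<le> c * (real n * real (inv_ackermann n))))
       \<and> (\<forall>i::nat. \<exists>c::real. \<forall>(n::nat) (m::nat) A.
            (\<exists>P. nested_disj_proof P A \<and> length P = n \<and> num_openings P = m) \<longrightarrow>
            (\<exists>Q. hluk_proof Q A \<and>
                 real (length Q) \<le> c * (real n * max 1 (real m * log_iter i (real m)))))"
proof -
  obtain K where "derived_rules K" using derived_rules_exists by blast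
  then interpret derived_rules K .
  have part1: "\<exists>Q. hluk_proof Q A \<and>
      real (length Q) \<le> real (76 * K + 4) * (real (length P) * real (inv_ackermann (length P)))"
    if P: "nested_disj_proof P A" for P A
  proof -
    define n where "n = length P"
    define \<alpha> where "\<alpha> = inv_ackermann n"
    have pos: "1 \<le> n" "1 \<le> \<alpha>"
      using P inv_ackermann_pos[of n] by (auto simp: n_def \<alpha>_def nested_disj_proof_def Suc_le_eq)
    have card: "card (contexts P) \<le> n + 1"
      using card_contexts[of P] num_openings_le[of P] by (simp add: n_def)
    \<comment> \<open>The inequality \<open>n < ackermann \<alpha> \<alpha>\<close> is strict, which
      makes room for the root of the tree.\<close>
    also have "\<dots> \<le> ackermann (\<alpha> + 2) 3"
      using less_ackermann_inv_ackermann[of n] ackermann_diagonal_le[of \<alpha>] by (simp add: \<alpha>_def)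
    finally obtain E where E: "trcl_steps (covers (contexts P)) (2 * (\<alpha> + 2 + 1) * 3 * card (contexts P)) E"
      "hop_bound (contexts P) (2 * (\<alpha> + 2) + 1) E"
      using ackermann_shortcuts[OF finite_contexts] by blast
    from simulation[OF P E] obtain Q where Q: "hluk_proof Q A"
      "length Q \<le> card (contexts P) + 2 * (\<alpha> + 2 + 1) * 3 * card (contexts P) * K +
         n * (3 * K * (2 * (\<alpha> + 2) + 1 + 2) + 1) + (K + 1)"
      unfolding n_def by blast
    have na: "n \<le> n * \<alpha>" "1 \<le> n * \<alpha>" using pos by auto
    have c2: "card (contexts P) \<le> 2 * n" using card pos by simp
    have "2 * (\<alpha> + 2 + 1) * 3 * card (contexts P) * K \<le> (24 * \<alpha>) * (2 * n) * K"
      using c2 pos by (intro mult_le_mono[OF mult_le_mono]) auto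
    moreover have "n * (3 * K * (2 * (\<alpha> + 2) + 1 + 2) + 1) \<le> n * (3 * K * (9 * \<alpha>) + 1)"
      using pos by (intro mult_le_mono add_le_mono) auto
    moreover have "K \<le> K * (n * \<alpha>)" using na by simp
    \<comment> \<open>The constant collects \<open>48 K + 27 K + K\<close> from shortcuts, lines and
      discharge, and \<open>2 + 1 + 1\<close> from the rest.\<close>
    ultimately have "length Q \<le> 2 * n + (24 * \<alpha>) * (2 * n) * K + n * (3 * K * (9 * \<alpha>) + 1) + (K * (n * \<alpha>) + n * \<alpha>)"
      using Q(2) c2 na by linarith
    also have "\<dots> \<le> (76 * K + 4) * (n * \<alpha>)"
      using na by (simp add: algebra_simps)
    finally have "real (length Q) \<le> real ((76 * K + 4) * (n * \<alpha>))" by (rule of_nat_mono)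
    then show ?thesis using Q(1) by (auto simp: n_def \<alpha>_def)
  qed
  have part2: "\<exists>Q. hluk_proof Q A \<and>
      real (length Q) \<le> real (13 * K + 4) * (real (length P) * max 1 (real (num_openings P) * log_iter i (real (num_openings P))))"
    if P: "nested_disj_proof P A" for P A i
  proof -
    define n m where "n = length P" and "m = num_openings P"
    \<comment> \<open>Replacing \<open>m\<close> by at least 1 keeps the bound positive when no
      assumption is opened.\<close>
    define M where "M = max 1 m"
    have n: "1 \<le> n" using P by (auto simp: n_def nested_disj_proof_def Suc_le_eq)
    have m: "m \<le> n" using num_openings_le[of P] by (simp add: n_def m_def)
    have card: "card (contexts P) \<le> m + 1" using card_contexts[of P] by (simp add: m_def)
    have "trcl_steps (covers (contexts P)) 0 (covers (contexts P))" by (rule trcl_steps.base)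
    from simulation[OF P this hop_bound_covers[OF finite_contexts]]
    obtain Q where Q: "hluk_proof Q A"
      "length Q \<le> card (contexts P) + n * (3 * K * (card (contexts P) + 2) + 1) + (K + 1)"
      unfolding n_def by auto
    have nM: "n \<le> n * M" "1 \<le> n * M" using n by (auto simp: M_def)
    have "card (contexts P) \<le> 2 * (n * M)" using card m n nM by linarith
    moreover have "n * (3 * K * (card (contexts P) + 2) + 1) \<le> n * (3 * K * (4 * M) + 1)"
      using card by (intro mult_le_mono add_le_mono) (auto simp: M_def)
    moreover have "K \<le> K * (n * M)" using nM by simp
    ultimately have "length Q \<le> 2 * (n * M) + n * (3 * K * (4 * M) + 1) + (K * (n * M) + n * M)"
      using Q(2) nM by linarith
    also have "\<dots> \<le> (13 * K + 4) * (n * M)"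
      using nM by (simp add: algebra_simps)
    finally have "real (length Q) \<le> real ((13 * K + 4) * (n * M))" by (rule of_nat_mono)
    also have "\<dots> = real (13 * K + 4) * (real n * real M)" by simp
    also have "\<dots> \<le> real (13 * K + 4) * (real n * max 1 (real m * log_iter i (real m)))"
    proof (intro mult_left_mono)
      show "real M \<le> max 1 (real m * log_iter i (real m))"
      proof (cases "2 \<le> m")
        case True
        then have "1 \<le> log_iter i (real m)" by (intro log_iter_ge_1) simp
        then have "real m * 1 \<le> real m * log_iter i (real m)" by (intro mult_left_mono) auto
        then show ?thesis using True by (simp add: M_def le_max_iff_disj)
      qed (simp add: M_def)
    qed auto
    finally show ?thesis using Q(1) by (auto simp: n_def m_def)
  qed
  show ?thesis using part1 part2 by blast
qed

end
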